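(* Let $\mathcal{M}$ be a non-orientable regular map (equivalently, a non-orientable regular $3$-maniplex) of type $\{p,q\}$, where at least one of $p$ or $q$ is odd. Then there exists an unstable, fully transitive, $2$-orbit $3$-maniplex $\mathcal{M}^\omega$ that covers $\mathcal{M}$. Moreover, for every $n>3$ there exist $2^{n-3}$ pairwise non-isomorphic unstable, fully transitive, $2$-orbit $n$-maniplexes whose $3$-faces (i.e. the connected components of the subgraph spanned by the edges of colours $0,1,2$) are isomorphic to $\mathcal{M}^\omega$.
   Context: An $n$-maniplex is a connected $n$-valent simple graph together with a proper edge-colouring with colours $\{0,\dots,n-1\}$ such that whenever $|i-j|>1$ the subgraph formed by the edges of colours $i$ and $j$ is a disjoint union of $4$-cycles. Its vertices are called flags; $u^i$ denotes the flag joined to $u$ by the edge of colour $i$. An automorphism is an edge-colour-preserving graph automorphism; $\mathrm{Aut}(\mathcal{M})$ acts semiregularly on flags. $\mathcal{M}$ is a $k$-orbit maniplex if $\mathrm{Aut}(\mathcal{M})$ has exactly $k$ orbits on flags; regular means $1$-orbit. For $i$, an $i$-face is a connected component of the subgraph obtained by deleting all edges of colour $i$; $\mathcal{M}$ is fully transitive if $\mathrm{Aut}(\mathcal{M})$ is transitive on the $i$-faces for every $i$. A maniplex is orientable if it is bipartite and non-orientable otherwise. A regular map is a regular $3$-maniplex; it has type $\{p,q\}$ if the components of the subgraph of edges of colours $0,1$ are cycles of length $2p$ and those of colours $1,2$ are cycles of length $2q$. A maniplex $\mathcal{N}$ covers $\mathcal{M}$ if there is a surjection from flags of $\mathcal{N}$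 to flags of $\mathcal{M}$ mapping $i$-adjacent flags to $i$-adjacent flags for all $i$. The canonical double cover $\widetilde{\mathcal{M}}$ of a non-orientable maniplex with flag set $\mathcal{F}$ has flag set $\mathcal{F}\times\mathbb{Z}_2$ with $(u,j)^i=(u^i,j+1)$; for $\varphi\in\mathrm{Aut}(\mathcal{M})$, $a\in\mathbb{Z}_2$ the maps $(u,j)\mapsto(u\varphi,j+a)$ are its expected automorphisms. A non-orientable maniplex is stable if every automorphism of $\widetilde{\mathcal{M}}$ is expected, and unstable otherwise. *)

theory Defs
  imports Main "HOL-Library.Z2"
begin

text \<open>
  Edges are two-element sets of flags. The values of \<open>colour\<close> on sets that are not edges are
  irrelevant, and isomorphisms ignore them. Flag sets may be infinite.
\<close>

record 'a cgraph =
  flags :: "'a set"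
  edges :: "'a set set"
  colour :: "'a set \<Rightarrow> nat"

definition simple_graph :: "'a cgraph \<Rightarrow> bool" where
  "simple_graph G \<longleftrightarrow>
     (\<forall>e \<in> edges G. \<exists>u \<in> flags G. \<exists>v \<in> flags G. u \<noteq> v \<and> e = {u, v})"

definition valent :: "nat \<Rightarrow> 'a cgraph \<Rightarrow> bool" where
  "valent n G \<longleftrightarrow>
     (\<forall>u \<in> flags G. finite {e \<in> edges G. u \<in> e} \<and> card {e \<in> edges G. u \<in> e} = n)"

definition proper_edge_colouring :: "nat \<Rightarrow> 'a cgraph \<Rightarrow> bool" where
  "proper_edge_colouring n G \<longleftrightarrow>
     (\<forall>e \<in> edges G. colour G e < n) \<and>
     (\<forall>e \<in> edges G. \<forall>f \<in> edges G. e \<noteq> f \<and> e \<inter> f \<noteq> {} \<longrightarrow> colour G e \<noteq> colour G f)"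

definition reachable :: "'a cgraph \<Rightarrow> ('a \<times> 'a) set" where
  "reachable G = {(u, v). u \<in> flags G \<and> v \<in> flags G \<and> (u, v) \<in> {(x, y). {x, y} \<in> edges G}\<^sup>*}"

definition connected_graph :: "'a cgraph \<Rightarrow> bool" where
  "connected_graph G \<longleftrightarrow> flags G \<noteq> {} \<and> (\<forall>u \<in> flags G. \<forall>v \<in> flags G. (u, v) \<in> reachable G)"

definition induced_subgraph :: "'a cgraph \<Rightarrow> 'a set \<Rightarrow> 'a cgraph" where
  "induced_subgraph G C = G\<lparr>flags := C, edges := {e \<in> edges G. e \<subseteq> C}\<rparr>"

definition conn_components :: "'a cgraph \<Rightarrow> 'a cgraph set" where
  "conn_components G = induced_subgraph G ` (flags G // reachable G)"

definition colour_subgraph :: "'a cgraph \<Rightarrow> nat set \<Rightarrow> 'a cgraph" where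
  "colour_subgraph G I = G\<lparr>edges := {e \<in> edges G. colour G e \<in> I}\<rparr>"

definition cycle_graph :: "nat \<Rightarrow> 'a cgraph \<Rightarrow> bool" where
  "cycle_graph k G \<longleftrightarrow> 3 \<le> k \<and>
     (\<exists>w. bij_betw w {..<k} (flags G) \<and> edges G = {{w i, w (Suc i mod k)} | i. i < k})"

definition maniplex :: "nat \<Rightarrow> 'a cgraph \<Rightarrow> bool" where
  "maniplex n G \<longleftrightarrow>
     simple_graph G \<and> connected_graph G \<and> valent n G \<and> proper_edge_colouring n G \<and>
     (\<forall>i < n. \<forall>j < n. \<bar>int i - int j\<bar> > 1 \<longrightarrow>
        (\<forall>C \<in> conn_components (colour_subgraph G {i, j}). cycle_graph 4 C))"

definition adjacent :: "'a cgraph \<Rightarrow> nat \<Rightarrow> 'a \<Rightarrow> 'a \<Rightarrow> bool" where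
  "adjacent G i u v \<longleftrightarrow> {u, v} \<in> edges G \<and> colour G {u, v} = i"

definition isomorphism :: "'a cgraph \<Rightarrow> 'b cgraph \<Rightarrow> ('a \<Rightarrow> 'b) \<Rightarrow> bool" where
  "isomorphism G H f \<longleftrightarrow>
     bij_betw f (flags G) (flags H) \<and> (\<lambda>e. f ` e) ` edges G = edges H \<and>
     (\<forall>e \<in> edges G. colour H (f ` e) = colour G e)"

definition isomorphic :: "'a cgraph \<Rightarrow> 'b cgraph \<Rightarrow> bool" where
  "isomorphic G H \<longleftrightarrow> (\<exists>f. isomorphism G H f)"

text \<open>Only the values of an automorphism on the flag set matter.\<close>

definition Aut :: "'a cgraph \<Rightarrow> ('a \<Rightarrow> 'a) set" where
  "Aut G = {\<phi>. isomorphism G G \<phi>}"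

definition flag_orbits :: "'a cgraph \<Rightarrow> 'a set set" where
  "flag_orbits G = flags G // {(u, v). u \<in> flags G \<and> v \<in> flags G \<and> (\<exists>\<phi> \<in> Aut G. \<phi> u = v)}"

definition k_orbit :: "nat \<Rightarrow> 'a cgraph \<Rightarrow> bool" where
  "k_orbit k G \<longleftrightarrow> finite (flag_orbits G) \<and> card (flag_orbits G) = k"

definition faces :: "'a cgraph \<Rightarrow> nat \<Rightarrow> 'a cgraph set" where
  "faces G i = conn_components (colour_subgraph G (- {i}))"

text \<open>
  A face is determined by its set of flags, so transitivity is expressed through flag sets.
\<close>

definition fully_transitive :: "nat \<Rightarrow> 'a cgraph \<Rightarrow> bool" where
  "fully_transitive n G \<longleftrightarrow>
     (\<forall>i < n. \<forall>F \<in> faces G i. \<forall>F' \<in> faces G i. \<exists>\<phi> \<in> Aut G. \<phi> ` flags F = flags F')"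

definition bipartite :: "'a cgraph \<Rightarrow> bool" where
  "bipartite G \<longleftrightarrow>
     (\<exists>A B. A \<union> B = flags G \<and> A \<inter> B = {} \<and> (\<forall>e \<in> edges G. \<exists>a \<in> A. \<exists>b \<in> B. e = {a, b}))"

definition orientable :: "'a cgraph \<Rightarrow> bool" where
  "orientable G \<longleftrightarrow> bipartite G"

definition regular_map :: "'a cgraph \<Rightarrow> bool" where
  "regular_map G \<longleftrightarrow> maniplex 3 G \<and> k_orbit 1 G"

definition has_type :: "'a cgraph \<Rightarrow> nat \<Rightarrow> nat \<Rightarrow> bool" where
  "has_type G p q \<longleftrightarrow>
     (\<forall>C \<in> conn_components (colour_subgraph G {0, 1}). cycle_graph (2 * p) C) \<and>
     (\<forall>C \<in> conn_components (colour_subgraph G {1, 2}). cycle_graph (2 * q) C)"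

definition covers :: "'b cgraph \<Rightarrow> 'a cgraph \<Rightarrow> bool" where
  "covers N G \<longleftrightarrow>
     (\<exists>f. f ` flags N = flags G \<and>
       (\<forall>i. \<forall>u \<in> flags N. \<forall>v \<in> flags N. adjacent N i u v \<longrightarrow> adjacent G i (f u) (f v)))"

text \<open>
  The edge of colour \<open>i\<close> between \<open>u\<close> and \<open>v\<close> gives edges of colour \<open>i\<close> between \<open>(u, j)\<close> and
  \<open>(v, j + 1)\<close>; the projection of such an edge to the first component is \<open>{u, v}\<close>.
\<close>

definition double_cover :: "'a cgraph \<Rightarrow> ('a \<times> bit) cgraph" where
  "double_cover G =
     \<lparr>flags = flags G \<times> UNIV,
      edges = {{(u, j), (v, j + 1)} | u v j. {u, v} \<in> edges G},
      colour = (\<lambda>e. colour G (fst ` e))\<rparr>"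

definition expected :: "'a cgraph \<Rightarrow> ('a \<times> bit \<Rightarrow> 'a \<times> bit) \<Rightarrow> bool" where
  "expected G \<psi> \<longleftrightarrow>
     (\<exists>\<phi> \<in> Aut G. \<exists>a. \<forall>u \<in> flags G. \<forall>j. \<psi> (u, j) = (\<phi> u, j + a))"

definition stable :: "'a cgraph \<Rightarrow> bool" where
  "stable G \<longleftrightarrow> \<not> orientable G \<and> (\<forall>\<psi> \<in> Aut (double_cover G). expected G \<psi>)"

definition unstable :: "'a cgraph \<Rightarrow> bool" where
  "unstable G \<longleftrightarrow> \<not> orientable G \<and> \<not> stable G"

text \<open>
  A maniplex is a connected graph of finite valency, so its flag set is countable. Hence every
  maniplex is isomorphic to one whose flags are natural numbers, and asserting the existence of
  maniplexes of type \<open>nat cgraph\<close> loses no generality.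
\<close>

end

theory Submission
  imports Defs "HOL-Library.Countable_Set"
begin

text \<open>
  Let the colours 0 and 2 act on the vertices of a square by \<open>x \<mapsto> 1 - x\<close>, colour 1 by
  \<open>x \<mapsto> - x\<close> and all other colours trivially, and let \<open>G\<close> be a group generated by involutions of
  colours \<open>0, \<dots>, n - 1\<close>, of which the first three generate the monodromy group of \<open>M\<close>. The
  flags of the covers are the elements of \<open>G \<times> \<int>\<^sub>4\<close>. Since \<open>p\<close> or \<open>q\<close> is odd and \<open>M\<close> is not
  orientable, some words act trivially on \<open>M\<close> but generate the dihedral group of the square; this
  gives connectedness and shows that the vertices stabilised by such a reflection form a union of
  orbits, so that \<open>x mod 2\<close> separates the two orbits. In the double cover the square unfolds to
  the regular representation of the dihedral group, which yields an unexpected automorphism.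
  For \<open>n > 3\<close>, the set \<open>E\<close> of colours \<open>i \<ge> 3\<close> whose involution does not commute with that of
  colour \<open>i - 1\<close> can be prescribed, and it is an isomorphism invariant.
\<close>

section \<open>Flag graphs given by involutions\<close>

text \<open>Orbits are formed with words rather than group elements because letters and lengths
  matter: parity of length decides bipartiteness, and one word acts on several sets at once.\<close>

definition orb :: "(nat \<Rightarrow> 'a \<Rightarrow> 'a) \<Rightarrow> nat set \<Rightarrow> 'a \<Rightarrow> 'a set" where
  "orb r I u = {foldr r w u | w. set w \<subseteq> I}"

lemma orb_refl: "u \<in> orb r I u"
proof -
  have "foldr r [] u = u" "set [] \<subseteq> I" by auto
  then show ?thesis unfolding orb_def by (metis (mono_tags, lifting) mem_Collect_eq)
qed

lemma orb_step: "v \<in> orb r I u \<Longrightarrow> i \<in> I \<Longrightarrow> r i v \<in> orb r I u"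
proof -
  assume "v \<in> orb r I u" "i \<in> I"
  then obtain w where "v = foldr r w u" "set w \<subseteq> I" by (auto simp: orb_def)
  then have "r i v = foldr r (i # w) u" "set (i # w) \<subseteq> I" using \<open>i \<in> I\<close> by auto
  then show ?thesis unfolding orb_def by blast
qed

lemma orb_induct [consumes 1, case_names refl step]:
  assumes "v \<in> orb r I u" "P u" "\<And>v i. v \<in> orb r I u \<Longrightarrow> P v \<Longrightarrow> i \<in> I \<Longrightarrow> P (r i v)"
  shows "P v"
proof -
  obtain w where w: "v = foldr r w u" "set w \<subseteq> I" using assms(1) by (auto simp: orb_def)
  have "P (foldr r w u)" using w(2)
  proof (induction w)
    case (Cons i w)
    then have "foldr r w u \<in> orb r I u" by (auto simp: orb_def)
    with Cons assms(3) show ?case by simp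
  qed (simp add: assms(2))
  then show ?thesis using w by simp
qed

lemma orb_trans: "v \<in> orb r I u \<Longrightarrow> x \<in> orb r I v \<Longrightarrow> x \<in> orb r I u"
  by (rotate_tac, induction rule: orb_induct) (auto intro: orb_step)

lemma foldr_rev_cancel:
  assumes "\<And>i u. r i (r i u) = u"
  shows "foldr r (rev w) (foldr r w u) = u"
  by (induction w arbitrary: u) (simp_all add: assms)

lemma orb_sym:
  assumes "\<And>i u. r i (r i u) = u" "v \<in> orb r I u"
  shows "u \<in> orb r I v"
proof -
  obtain w where w: "v = foldr r w u" "set w \<subseteq> I" using assms(2) by (auto simp: orb_def)
  have "u = foldr r (rev w) v" using foldr_rev_cancel[of r w u, OF assms(1)] w(1) by simp
  then show ?thesis using w(2) unfolding orb_def by fastforce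
qed

lemma orb_eq:
  assumes "\<And>i u. r i (r i u) = u" "v \<in> orb r I u"
  shows "orb r I v = orb r I u"
  using orb_sym[OF assms] assms(2) by (auto intro: orb_trans)

text \<open>Connectedness and commutation are left out so that components and double covers are
  instances as well. The involution law holds on the whole type, hence rewrites without side
  conditions.\<close>

locale flag_graph =
  fixes n :: nat and G :: "'a cgraph" and r :: "nat \<Rightarrow> 'a \<Rightarrow> 'a"
  assumes invol [simp]: "r i (r i u) = u"
    and closed: "i < n \<Longrightarrow> u \<in> flags G \<Longrightarrow> r i u \<in> flags G"
    and no_fix: "i < n \<Longrightarrow> u \<in> flags G \<Longrightarrow> r i u \<noteq> u"
    and edges_eq: "edges G = {{u, r i u} | u i. u \<in> flags G \<and> i < n}"
    and colour_eq: "i < n \<Longrightarrow> u \<in> flags G \<Longrightarrow> colour G {u, r i u} = i"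
begin

lemma r_inj: "i < n \<Longrightarrow> j < n \<Longrightarrow> u \<in> flags G \<Longrightarrow> r i u = r j u \<Longrightarrow> i = j"
  using colour_eq by metis

lemma edge_iff: "{u, v} \<in> edges G \<longleftrightarrow> u \<in> flags G \<and> (\<exists>i<n. v = r i u)"
proof
  assume "{u, v} \<in> edges G"
  then obtain x i where x: "{u, v} = {x, r i x}" "x \<in> flags G" "i < n" by (auto simp: edges_eq)
  then consider "u = x" "v = r i x" | "u = r i x" "v = x" by (auto simp: doubleton_eq_iff)
  then show "u \<in> flags G \<and> (\<exists>i<n. v = r i u)"
    by cases (use x closed in auto)
qed (auto simp: edges_eq)

lemma adjacent_iff: "adjacent G i u v \<longleftrightarrow> i < n \<and> u \<in> flags G \<and> v = r i u"
  unfolding adjacent_def edge_iff using colour_eq by auto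

lemma foldr_closed: "set w \<subseteq> {..<n} \<Longrightarrow> u \<in> flags G \<Longrightarrow> foldr r w u \<in> flags G"
  by (induction w) (auto intro: closed)

lemma orb_flags: "I \<subseteq> {..<n} \<Longrightarrow> u \<in> flags G \<Longrightarrow> orb r I u \<subseteq> flags G"
  unfolding orb_def using foldr_closed by blast

lemma subgraph_edge_iff:
  "{u, v} \<in> edges (colour_subgraph G I) \<longleftrightarrow> u \<in> flags G \<and> (\<exists>i \<in> I \<inter> {..<n}. v = r i u)"
proof -
  have "{u, v} \<in> edges (colour_subgraph G I) \<longleftrightarrow> {u, v} \<in> edges G \<and> colour G {u, v} \<in> I"
    by (simp add: colour_subgraph_def)
  then show ?thesis unfolding edge_iff using colour_eq by auto
qed

lemma reachable_subgraph:
  assumes u: "u \<in> flags G"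
  shows "reachable (colour_subgraph G I) `` {u} = orb r (I \<inter> {..<n}) u"
proof -
  define R where "R = {(x, y). {x, y} \<in> edges (colour_subgraph G I)}"
  have R_iff: "(x, y) \<in> R \<longleftrightarrow> x \<in> flags G \<and> (\<exists>i \<in> I \<inter> {..<n}. y = r i x)" for x y
    by (simp only: R_def mem_Collect_eq case_prod_conv subgraph_edge_iff)
  have "v \<in> orb r (I \<inter> {..<n}) u" if "(u, v) \<in> R\<^sup>*" for v
    using that by induction (auto simp: R_iff intro: orb_refl orb_step)
  moreover have "(u, v) \<in> R\<^sup>* \<and> v \<in> flags G" if "v \<in> orb r (I \<inter> {..<n}) u" for v
    using that
  proof (induction rule: orb_induct)
    case (step v i)
    then have "(v, r i v) \<in> R" unfolding R_iff by blast
    with step show ?case by (auto intro: closed)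
  qed (use u in simp)
  ultimately show ?thesis
    using u by (auto simp: reachable_def colour_subgraph_def R_def[symmetric] R_def)
qed

lemma conn_components_iff:
  "C \<in> conn_components (colour_subgraph G I) \<longleftrightarrow>
     (\<exists>u \<in> flags G. C = induced_subgraph (colour_subgraph G I) (orb r (I \<inter> {..<n}) u))"
proof -
  have "flags (colour_subgraph G I) = flags G" by (simp add: colour_subgraph_def)
  then show ?thesis
    unfolding conn_components_def quotient_def
    by (auto simp: reachable_subgraph image_iff)
qed

lemma colour_subgraph_UNIV: "colour_subgraph G UNIV = G"
  by (simp add: colour_subgraph_def)

lemma connected_iff:
  "connected_graph G \<longleftrightarrow> flags G \<noteq> {} \<and> (\<forall>u \<in> flags G. flags G \<subseteq> orb r {..<n} u)"
proof -
  have "(u, v) \<in> reachable G \<longleftrightarrow> v \<in> orb r {..<n} u" if "u \<in> flags G" for u v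
    using reachable_subgraph[OF that, of UNIV] by (auto simp: colour_subgraph_UNIV)
  then show ?thesis unfolding connected_graph_def by blast
qed

section \<open>The graph axioms of a maniplex\<close>

lemma simple_graph: "simple_graph G"
  unfolding simple_graph_def
proof
  fix e assume "e \<in> edges G"
  then obtain u i where u: "e = {u, r i u}" "u \<in> flags G" "i < n" by (auto simp: edges_eq)
  then have "r i u \<in> flags G" "u \<noteq> r i u" using closed no_fix[of i u] by auto
  then show "\<exists>u \<in> flags G. \<exists>v \<in> flags G. u \<noteq> v \<and> e = {u, v}" using u by blast
qed

lemma valent: "valent n G"
  unfolding valent_def
proof
  fix u assume u: "u \<in> flags G"
  have "{e \<in> edges G. u \<in> e} = (\<lambda>i. {u, r i u}) ` {..<n}"
  proof (intro equalityI subsetI)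
    fix e assume "e \<in> {e \<in> edges G. u \<in> e}"
    then obtain v where "e = {u, v}" "{u, v} \<in> edges G" using simple_graph
      by (fastforce simp: simple_graph_def insert_commute)
    then show "e \<in> (\<lambda>i. {u, r i u}) ` {..<n}" by (auto simp: edge_iff)
  qed (use u in \<open>auto simp: edges_eq\<close>)
  moreover have "inj_on (\<lambda>i. {u, r i u}) {..<n}"
    by (rule inj_onI) (metis colour_eq lessThan_iff u)
  ultimately show "finite {e \<in> edges G. u \<in> e} \<and> card {e \<in> edges G. u \<in> e} = n"
    by (simp add: card_image)
qed

lemma proper_edge_colouring: "proper_edge_colouring n G"
proof -
  have "e = f" if ef: "e \<in> edges G" "f \<in> edges G" "e \<inter> f \<noteq> {}" "colour G e = colour G f" for e f
  proof -
    have *: "e = {x, r (colour G e) x}" if "e \<in> edges G" "x \<in> e" for e x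
    proof -
      from \<open>e \<in> edges G\<close> obtain u i where u: "e = {u, r i u}" "u \<in> flags G" "i < n" 
        by (auto simp: edges_eq)
      then have "colour G e = i" by (simp add: colour_eq)
      then show ?thesis using u(1) that(2) by auto
    qed
    obtain x where "x \<in> e" "x \<in> f" using ef by auto
    then show ?thesis using *[of e x] *[of f x] ef by simp
  qed
  moreover have "colour G e < n" if "e \<in> edges G" for e
    using that by (auto simp: edges_eq colour_eq)
  ultimately show ?thesis unfolding proper_edge_colouring_def by blast
qed

lemma component_edges:
  assumes u: "u \<in> flags G" and I: "I \<subseteq> {..<n}"
  shows "edges (induced_subgraph (colour_subgraph G I) (orb r I u)) =
    {{x, r i x} | x i. x \<in> orb r I u \<and> i \<in> I}"
proof -
  have "e \<in> edges (induced_subgraph (colour_subgraph G I) (orb r I u)) \<longleftrightarrow>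
    (\<exists>x i. x \<in> flags G \<and> i < n \<and> e = {x, r i x} \<and> colour G e \<in> I \<and> e \<subseteq> orb r I u)" for e
    by (auto simp: induced_subgraph_def colour_subgraph_def edges_eq)
  also have "\<dots> e \<longleftrightarrow> (\<exists>x i. x \<in> orb r I u \<and> i \<in> I \<and> e = {x, r i x})" for e
  proof (intro iffI; clarify)
    fix x i assume "x \<in> flags G" "i < n" "colour G {x, r i x} \<in> I" "{x, r i x} \<subseteq> orb r I u"
    then show "\<exists>xa ia. xa \<in> orb r I u \<and> ia \<in> I \<and> {x, r i x} = {xa, r ia xa}"
      using colour_eq by auto
  next
    fix x i assume x: "x \<in> orb r I u" "i \<in> I"
    then have "x \<in> flags G" "r i x \<in> orb r I u" "i < n"
      using orb_flags[OF I u] orb_step[OF x(1)] I by auto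
    then show "\<exists>xa ia. xa \<in> flags G \<and> ia < n \<and> {x, r i x} = {xa, r ia xa} \<and>
        colour G {x, r i x} \<in> I \<and> {x, r i x} \<subseteq> orb r I u"
      using x colour_eq[of i x] by (intro exI[of _ x] exI[of _ i]) auto
  qed
  finally show ?thesis by blast
qed

text \<open>Two commuting involutions reach at most four flags from \<open>u\<close>. Opposite
  corners differ because colours \<open>i\<close> and \<open>j\<close> lead from \<open>u\<close> to
  different flags.\<close>

lemma cycle_graph_4:
  assumes ij: "i < n" "j < n" "i \<noteq> j" and comm: "\<And>u. u \<in> flags G \<Longrightarrow> r i (r j u) = r j (r i u)"
    and C: "C \<in> conn_components (colour_subgraph G {i, j})"
  shows "cycle_graph 4 C"
proof -
  have I: "{i, j} \<inter> {..<n} = {i, j}" using ij by auto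
  obtain u where u: "u \<in> flags G" and C_eq: "C = induced_subgraph (colour_subgraph G {i, j}) (orb r {i, j} u)"
    using C unfolding conn_components_iff I by blast
  define K where "K = {u, r i u, r j (r i u), r j u}"
  have rr: "r i (r j u) = r j (r i u)" "r i (r j (r i u)) = r j u"
    using comm[OF u] comm[OF closed[OF ij(1) u]] by simp_all
  have "v \<in> K" if "v \<in> orb r {i, j} u" for v
    using that by (induction rule: orb_induct) (auto simp: K_def rr)
  moreover have "K \<subseteq> orb r {i, j} u"
    unfolding K_def using orb_refl[of u r "{i, j}"] by (auto intro!: orb_step)
  ultimately have K: "orb r {i, j} u = K" by auto
  have Kf: "K \<subseteq> flags G" using u ij by (auto simp: K_def closed)
  have ne: "r i u \<noteq> r j u" using r_inj ij u by blast
  have ne2: "r j (r i u) \<noteq> u" using ne by (metis invol)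
  define w where "w = (!) [u, r i u, r j (r i u), r j u]"
  have fl: "flags C = K" by (simp add: C_eq K induced_subgraph_def)
  have lt4: "{..<4::nat} = {0, 1, 2, 3}" by auto
  have "bij_betw w {..<4} (flags C)"
    unfolding bij_betw_def fl lt4 using ne ne2 no_fix[OF ij(1) u] no_fix[OF ij(2) u] 
      no_fix[OF ij(2) closed[OF ij(1) u]] no_fix[OF ij(1) closed[OF ij(2) u]] rr
    by (auto simp: w_def K_def)
  moreover have "edges C = {{w k, w (Suc k mod 4)} | k. k < 4}"
  proof -
    have "edges C = {{x, r c x} | x c. x \<in> K \<and> c \<in> {i, j}}"
      unfolding C_eq using component_edges[OF u, of "{i, j}"] ij by (simp add: K)
    then have "edges C = (\<lambda>x. {x, r i x}) ` K \<union> (\<lambda>x. {x, r j x}) ` K" by blast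
    also have "\<dots> = {{u, r i u}, {r i u, r j (r i u)}, {r j (r i u), r j u}, {r j u, u}}"
    proof -
      \<comment> \<open>Each of the four edges arises twice, once from either end.\<close>
      have "{A, A, B, B} \<union> {D, E, E, D} = {A, E, B, D}" for A B D E :: "'a set" by blast
      then show ?thesis
        by (simp add: K_def rr insert_commute[of "r i u" u] insert_commute[of "r j u" "r j (r i u)"]
          insert_commute[of "r j (r i u)" "r i u"] insert_commute[of u "r j u"] del: Un_insert_left)
    qed
    also have "\<dots> = (\<lambda>k. {w k, w (Suc k mod 4)}) ` {..<4}"
      unfolding lt4 by (simp add: w_def)
    also have "\<dots> = {{w k, w (Suc k mod 4)} | k. k < 4}" by auto
    finally show ?thesis .
  qed
  ultimately show ?thesis unfolding cycle_graph_def by fastforce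
qed

lemma maniplexI:
  assumes "flags G \<noteq> {}" "\<And>u. u \<in> flags G \<Longrightarrow> flags G \<subseteq> orb r {..<n} u"
    and "\<And>i j u. i < n \<Longrightarrow> j < n \<Longrightarrow> \<bar>int i - int j\<bar> > 1 \<Longrightarrow> u \<in> flags G \<Longrightarrow> r i (r j u) = r j (r i u)"
  shows "maniplex n G"
  unfolding maniplex_def
proof (intro conjI allI impI ballI)
  fix i j C assume "i < n" "j < n" "\<bar>int i - int j\<bar> > 1" "C \<in> conn_components (colour_subgraph G {i, j})"
  then show "cycle_graph 4 C" by (intro cycle_graph_4[of i j]) (auto intro: assms(3))
qed (use assms in \<open>auto simp: connected_iff simple_graph valent proper_edge_colouring\<close>)

text \<open>Every letter of a word switches the class of the flag, so only words of even length can
  close up.\<close>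

lemma bipartite_foldr:
  assumes "bipartite G" "set w \<subseteq> {..<n}" "u \<in> flags G" "foldr r w u = u"
  shows "even (length w)"
proof -
  obtain A B where AB: "A \<union> B = flags G" "A \<inter> B = {}" "\<And>e. e \<in> edges G \<Longrightarrow> \<exists>a \<in> A. \<exists>b \<in> B. e = {a, b}"
    using assms(1) by (auto simp: bipartite_def)
  have flip: "r i v \<in> A \<longleftrightarrow> v \<notin> A" if "v \<in> flags G" "i < n" for i v
  proof -
    have "{v, r i v} \<in> edges G" using that by (auto simp: edges_eq)
    with AB(3) obtain a b where "a \<in> A" "b \<in> B" "{v, r i v} = {a, b}" by blast
    then show ?thesis using AB(2) by (auto simp: doubleton_eq_iff)
  qed
  have "set w \<subseteq> {..<n} \<Longrightarrow> foldr r w u \<in> A \<longleftrightarrow> (u \<in> A \<longleftrightarrow> even (length w))" for w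
    by (induction w) (use assms(3) in \<open>auto simp: flip foldr_closed\<close>)
  from this[OF assms(2)] show ?thesis using assms(4) by auto
qed

text \<open>The two classes are the flags reached from \<open>u\<close> by even and by odd
  words.\<close>

lemma bipartiteI:
  assumes "u \<in> flags G" "flags G \<subseteq> orb r {..<n} u"
    and even: "\<And>w. set w \<subseteq> {..<n} \<Longrightarrow> foldr r w u = u \<Longrightarrow> even (length w)"
  shows "bipartite G"
proof -
  define S where "S b = {foldr r w u | w. set w \<subseteq> {..<n} \<and> even (length w) = b}" for b
  have "S True \<inter> S False = {}"
  proof -
    have False if "foldr r w u = foldr r w' u" "set w \<subseteq> {..<n}" "set w' \<subseteq> {..<n}"
      "even (length w)" "odd (length w')" for w w'
    proof -
      \<comment> \<open>Going out by one word and back by the other would be a closed word of odd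
        length.\<close>
      have "foldr r (rev w' @ w) u = u"
        using that(1) foldr_rev_cancel[of r w' u] by simp
      then show False using even[of "rev w' @ w"] that by auto
    qed
    then show ?thesis unfolding S_def by blast
  qed
  moreover have U: "S True \<union> S False = flags G"
    using assms(1,2) foldr_closed unfolding S_def orb_def by blast
  moreover have step: "r i v \<in> S (\<not> b)" if v: "v \<in> S b" "i < n" for i v b
  proof -
    obtain w where "v = foldr r w u" "set w \<subseteq> {..<n}" "even (length w) = b"
      using v(1) unfolding S_def by blast
    then have "r i v = foldr r (i # w) u" "set (i # w) \<subseteq> {..<n}" "even (length (i # w)) = (\<not> b)"
      using v(2) by auto
    then show ?thesis unfolding S_def by blast
  qed
  moreover have "\<exists>a \<in> S True. \<exists>b \<in> S False. e = {a, b}" if e: "e \<in> edges G" for e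
  proof -
    obtain v i where v: "e = {v, r i v}" "v \<in> flags G" "i < n" using e by (auto simp: edges_eq)
    then consider "v \<in> S True" | "v \<in> S False" using U by blast
    then show ?thesis
    proof cases
      case 1
      then have "r i v \<in> S False" using step[of v True i] v by simp
      then show ?thesis using 1 v by blast
    next
      case 2
      then have "r i v \<in> S True" using step[of v False i] v by simp
      then show ?thesis using 2 v by (metis insert_commute)
    qed
  qed
  ultimately show ?thesis unfolding bipartite_def
    by (intro exI[of _ "S True"] exI[of _ "S False"] conjI ballI)
qed

lemma flag_graph_component:
  assumes "m \<le> n" "u \<in> flags G"
  shows "flag_graph m (induced_subgraph (colour_subgraph G {..<m}) (orb r {..<m} u)) r"
proof -
  have sub: "orb r {..<m} u \<subseteq> flags G" using assms by (intro orb_flags) auto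
  show ?thesis
  proof
    show "edges (induced_subgraph (colour_subgraph G {..<m}) (orb r {..<m} u)) =
        {{x, r i x} | x i. x \<in> flags (induced_subgraph (colour_subgraph G {..<m}) (orb r {..<m} u)) \<and> i < m}"
      using component_edges[OF assms(2), of "{..<m}"] assms(1) by (simp add: induced_subgraph_def)
  qed (use sub assms(1) in \<open>auto simp: induced_subgraph_def colour_subgraph_def colour_eq no_fix subset_iff intro: orb_step\<close>)
qed

lemma flag_graph_double_cover:
  "flag_graph n (double_cover G) (\<lambda>i (u, j). (r i u, j + 1))"
proof
  have "edges (double_cover G) = {{(u, j), (r i u, j + 1)} | u i j. u \<in> flags G \<and> i < n}"
    by (auto simp: double_cover_def edge_iff) 
  then show "edges (double_cover G) =
      {{u, (\<lambda>(u, j). (r i u, j + 1)) u} | u i. u \<in> flags (double_cover G) \<and> i < n}"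
    by (auto simp: double_cover_def)
qed (auto simp: double_cover_def closed no_fix colour_eq split: prod.splits)

end

text \<open>Every edge is a flag with its image under a coloured involution, so a bijection respects
  edges and colours once it is equivariant.\<close>

lemma isomorphism_iff:
  assumes "flag_graph n G r" "flag_graph n H s"
  shows "isomorphism G H f \<longleftrightarrow>
    bij_betw f (flags G) (flags H) \<and> (\<forall>u \<in> flags G. \<forall>i<n. f (r i u) = s i (f u))"
proof -
  interpret G: flag_graph n G r by fact
  interpret H: flag_graph n H s by fact
  show ?thesis
  proof (intro iffI conjI ballI allI impI)
    fix u i assume iso: "isomorphism G H f" and u: "u \<in> flags G" "i < n"
    have e: "{u, r i u} \<in> edges G" using u by (auto simp: G.edges_eq)
    then have "f ` {u, r i u} \<in> edges H" "colour H (f ` {u, r i u}) = i"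
      using iso u G.colour_eq unfolding isomorphism_def by (metis image_eqI)+
    then have "adjacent H i (f u) (f (r i u))" by (simp add: adjacent_def)
    then show "f (r i u) = s i (f u)" by (simp add: H.adjacent_iff)
  next
    assume "isomorphism G H f"
    then show "bij_betw f (flags G) (flags H)" by (simp add: isomorphism_def)
  next
    assume f: "bij_betw f (flags G) (flags H) \<and> (\<forall>u \<in> flags G. \<forall>i<n. f (r i u) = s i (f u))"
    then have fim: "f ` flags G = flags H" by (simp add: bij_betw_def)
    have "(\<lambda>e. f ` e) ` edges G = edges H"
    proof (intro equalityI subsetI)
      fix e assume "e \<in> (\<lambda>e. f ` e) ` edges G"
      then show "e \<in> edges H" using f fim by (fastforce simp: G.edges_eq H.edges_eq)
    next
      fix e assume "e \<in> edges H"
      then obtain v i where "e = {v, s i v}" "v \<in> flags H" "i < n" by (auto simp: H.edges_eq)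
      moreover then obtain u where "v = f u" "u \<in> flags G" using fim by auto
      ultimately have "e = f ` {u, r i u}" "{u, r i u} \<in> edges G" using f by (auto simp: G.edges_eq)
      then show "e \<in> (\<lambda>e. f ` e) ` edges G" by blast
    qed
    moreover have "colour H (f ` e) = colour G e" if e: "e \<in> edges G" for e
      proof -
      obtain u i where u: "e = {u, r i u}" "u \<in> flags G" "i < n" using e by (auto simp: G.edges_eq)
      then have "f ` e = {f u, s i (f u)}" "f u \<in> flags H" using f fim by auto
      then show ?thesis using u by (simp add: G.colour_eq H.colour_eq)
    qed
    ultimately show "isomorphism G H f" using f by (simp add: isomorphism_def)
  qed
qed

lemma isomorphism_foldr:
  assumes "flag_graph n G r" "flag_graph n H s" "isomorphism G H f" "u \<in> flags G" "set w \<subseteq> {..<n}"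
  shows "f (foldr r w u) = foldr s w (f u)"
  using assms(5)
proof (induction w)
  case (Cons i w)
  then show ?case
    using assms(1-4) isomorphism_iff[OF assms(1,2)] flag_graph.foldr_closed[OF assms(1)] by simp
qed simp

section \<open>Non-orientable regular maps\<close>

text \<open>The default value \<open>u\<close> makes this an involution on the whole type for every
  graph of interest, trivial off the flags.\<close>

definition partner :: "'a cgraph \<Rightarrow> nat \<Rightarrow> 'a \<Rightarrow> 'a" where
  "partner G i u = (if \<exists>v. adjacent G i u v then THE v. adjacent G i u v else u)"

text \<open>The \<open>n\<close> edges at a flag have distinct colours below \<open>n\<close>, so by
  counting each colour occurs exactly once.\<close>

lemma flag_graph_partner:
  assumes "maniplex n G"
  shows "flag_graph n G (partner G)"
    and "u \<notin> flags G \<Longrightarrow> partner G i u = u"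
proof -
  have simple: "\<exists>u \<in> flags G. \<exists>v \<in> flags G. u \<noteq> v \<and> e = {u, v}" if "e \<in> edges G" for e
    using assms that by (auto simp: maniplex_def simple_graph_def)
  have col: "colour G e < n" if "e \<in> edges G" for e
    using assms that by (auto simp: maniplex_def proper_edge_colouring_def)
  have col_inj: "e = f"
    if "e \<in> edges G" "f \<in> edges G" "e \<inter> f \<noteq> {}" "colour G e = colour G f" for e f
    using assms that by (auto simp: maniplex_def proper_edge_colouring_def)
  have val: "card {e \<in> edges G. u \<in> e} = n" if "u \<in> flags G" for u
    using assms that by (auto simp: maniplex_def valent_def)
  have adj: "u \<in> flags G" "v \<in> flags G" "u \<noteq> v" "i < n" if "adjacent G i u v" for i u v
    using that simple[of "{u, v}"] col[of "{u, v}"]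
    by (auto simp: adjacent_def doubleton_eq_iff)
  have uniq: "v = v'" if "adjacent G i u v" "adjacent G i u v'" for i u v v'
  proof -
    have "{u, v} = {u, v'}" using that col_inj[of "{u, v}" "{u, v'}"] by (auto simp: adjacent_def)
    then show ?thesis by (auto simp: doubleton_eq_iff)
  qed
  have partner: "partner G i u = v" if "adjacent G i u v" for i u v
    using that uniq unfolding partner_def by (metis theI)
  have ex: "adjacent G i u (partner G i u)" if iu: "i < n" "u \<in> flags G" for i u
  proof -
    let ?E = "{e \<in> edges G. u \<in> e}"
    have "inj_on (colour G) ?E" by (intro inj_onI col_inj) auto
    then have "card (colour G ` ?E) = n" using val[OF iu(2)] by (simp add: card_image)
    moreover have "colour G ` ?E \<subseteq> {..<n}" using col by auto
    ultimately have "colour G ` ?E = {..<n}" by (intro card_subset_eq) auto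
    then have "i \<in> colour G ` ?E" using iu(1) by simp
    then obtain e where e: "e \<in> edges G" "u \<in> e" "colour G e = i" by auto
    obtain x y where "e = {x, y}" using simple[OF e(1)] by blast
    then obtain v where "e = {u, v}" using e(2) by (cases "u = x") auto
    then have "adjacent G i u v" using e by (simp add: adjacent_def)
    then show ?thesis using partner by metis
  qed
  have sym: "adjacent G i v u" if "adjacent G i u v" for i u v
    using that by (simp add: adjacent_def insert_commute)
  show "partner G i u = u" if "u \<notin> flags G"
    using that adj(1) by (auto simp: partner_def)
  show "flag_graph n G (partner G)"
  proof
    show "partner G i (partner G i u) = u" for i u
      by (cases "\<exists>v. adjacent G i u v") (metis partner sym, simp add: partner_def)
    show "partner G i u \<in> flags G" if "i < n" "u \<in> flags G" for i u
      using adj(2) ex[OF that] by blast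
    show "partner G i u \<noteq> u" if "i < n" "u \<in> flags G" for i u
      using adj(3) ex[OF that] by metis
    show "colour G {u, partner G i u} = i" if "i < n" "u \<in> flags G" for i u
      using ex[OF that] by (simp add: adjacent_def)
    have "\<exists>u i. e = {u, partner G i u} \<and> u \<in> flags G \<and> i < n" if e: "e \<in> edges G" for e
    proof -
      obtain u v where "e = {u, v}" using simple[OF e] by blast
      then have "adjacent G (colour G e) u v" using e by (simp add: adjacent_def)
      then show ?thesis using \<open>e = {u, v}\<close> adj partner by metis
    qed
    moreover have "{u, partner G i u} \<in> edges G" if "i < n" "u \<in> flags G" for i u
      using ex[OF that] by (simp add: adjacent_def)
    ultimately show "edges G = {{u, partner G i u} | u i. u \<in> flags G \<and> i < n}" by blast
  qed
qed

section \<open>Cycle lengths as relations between involutions\<close>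

lemma funpow_comp_inverse:
  assumes "\<And>x. f (f x) = x" "\<And>x. g (g x) = x"
  shows "((f \<circ> g) ^^ k) (((g \<circ> f) ^^ k) x) = x"
proof (induction k)
  case (Suc k)
  have "((f \<circ> g) ^^ Suc k) (((g \<circ> f) ^^ Suc k) x) =
      ((f \<circ> g) ^^ k) (f (g (g (f (((g \<circ> f) ^^ k) x)))))"
    unfolding funpow_Suc_right[of k "f \<circ> g"] by simp
  then show ?case using Suc by (simp only: assms)
qed simp

lemma funpow_odd_involution:
  assumes "f \<circ> f = id" "odd k"
  shows "f ^^ k = f"
proof -
  have "f ^^ 2 = id" using assms(1) by (simp add: numeral_2_eq_2)
  then have "f ^^ (2 * l) = id" for l by (simp add: funpow_mult[symmetric])
  then show ?thesis using assms(2) by (elim oddE) simp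
qed

context flag_graph
begin

text \<open>A walk along the cycle never turns back, so its colours alternate; one full turn is
  \<open>p\<close> applications of a product of the two involutions.\<close>

lemma cycle_relation:
  assumes ij: "i < n" "j < n" "i \<noteq> j" and u: "u \<in> flags G"
    and cyc: "\<And>C. C \<in> conn_components (colour_subgraph G {i, j}) \<Longrightarrow> cycle_graph (2 * p) C"
  shows "((r i \<circ> r j) ^^ p) u = u"
proof -
  define C where "C = induced_subgraph (colour_subgraph G {i, j}) (orb r {i, j} u)"
  have "{i, j} \<inter> {..<n} = {i, j}" using ij by auto
  then have "C \<in> conn_components (colour_subgraph G {i, j})"
    using u unfolding conn_components_iff C_def by auto
  then have "cycle_graph (2 * p) C" by (rule cyc)
  moreover have fl: "flags C = orb r {i, j} u" by (simp add: C_def induced_subgraph_def)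
  ultimately obtain w where p: "3 \<le> 2 * p" and w: "bij_betw w {..<2 * p} (orb r {i, j} u)"
    and edges: "edges C = {{w k, w (Suc k mod (2 * p))} | k. k < 2 * p}"
    by (auto simp: cycle_graph_def)
  \<comment> \<open>The periodic extension of \<open>w\<close>, so that steps past the end need no
    separate case.\<close>
  define W where "W k = w (k mod (2 * p))" for k
  have colours: "\<exists>c \<in> {i, j}. W (Suc k) = r c (W k)" for k
  proof -
    have "{W k, W (Suc k)} \<in> edges C"
      unfolding edges W_def using p
      by (intro CollectI exI[of _ "k mod (2 * p)"]) (auto simp: mod_Suc_eq)
    then have "{W k, W (Suc k)} \<in> edges (colour_subgraph G {i, j})"
      by (simp add: C_def induced_subgraph_def)
    then show ?thesis by (auto simp: subgraph_edge_iff)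
  qed
  \<comment> \<open>No turning back: \<open>2 * p\<close> is at least 3 and hence does not divide
    2.\<close>
  have W2: "W (Suc (Suc k)) \<noteq> W k" for k
  proof
    assume "W (Suc (Suc k)) = W k"
    then have "(k + 2) mod (2 * p) = (k + 0) mod (2 * p)"
      using w p unfolding W_def bij_betw_def inj_on_def by simp
    then have "2 * p dvd (k + 2) - k" by (subst mod_eq_dvd_iff_nat[symmetric]) auto
    then show False using p by (auto dest: dvd_imp_le)
  qed
  have "u \<in> w ` {..<2 * p}" using w orb_refl[of u r] by (simp add: bij_betw_def)
  then obtain k where "u = w k" "k < 2 * p" by auto
  then have k: "W k = u" by (simp add: W_def)
  have walk: "((r c' \<circ> r c) ^^ p) u = u"
    if c: "{c, c'} = {i, j}" and "W (Suc k) = r c u" for c c'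
  proof -
    have "W (k + 2 * l) = ((r c' \<circ> r c) ^^ l) u \<and> W (Suc (k + 2 * l)) = r c (W (k + 2 * l))" for l
    proof (induction l)
      case (Suc l)
      have alternate: "W (Suc (Suc m)) = r d' (W (Suc m))" if "W (Suc m) = r d (W m)" "{d, d'} = {i, j}" for m d d'
      proof -
        obtain e where "e \<in> {i, j}" and e: "W (Suc (Suc m)) = r e (W (Suc m))" using colours by blast
        moreover have "e \<noteq> d" using W2[of m] that(1) e by auto
        ultimately show ?thesis using that(2) by auto
      qed
      have 1: "W (Suc (Suc (k + 2 * l))) = r c' (W (Suc (k + 2 * l)))"
        using Suc c by (intro alternate[of _ c]) auto
      then have "W (Suc (Suc (Suc (k + 2 * l)))) = r c (W (Suc (Suc (k + 2 * l))))"
        using c alternate[of "Suc (k + 2 * l)" c' c] by (simp add: insert_commute)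
      with 1 Suc show ?case by simp
    qed (use k that in auto)
    from this[of p] have "W (k + 2 * p) = ((r c' \<circ> r c) ^^ p) u" by blast
    then show ?thesis using k by (simp add: W_def)
  qed
  obtain c where "c \<in> {i, j}" "W (Suc k) = r c u" using colours k by metis
  \<comment> \<open>Either colour may come first, depending on the numbering of the cycle. The two
    products are inverse to each other, so both cases suffice.\<close>
  then have "((r i \<circ> r j) ^^ p) u = u \<or> ((r j \<circ> r i) ^^ p) u = u"
    using walk[of i j] walk[of j i] by auto
  then show ?thesis using funpow_comp_inverse[of "r i" "r j" p u] by auto
qed

end

section \<open>Words in colours 0 and 1\<close>

fun alt :: "nat \<Rightarrow> nat \<Rightarrow> nat list" where
  "alt x 0 = []"
| "alt x (Suc m) = x # alt (1 - x) m"

lemma alt_snoc: "x \<le> 1 \<Longrightarrow> alt x (Suc m) = alt x m @ [if even m then x else 1 - x]"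
proof (induction m arbitrary: x)
  case (Suc m)
  have "alt x (Suc (Suc m)) = x # alt (1 - x) (Suc m)" by simp
  also have "\<dots> = x # alt (1 - x) m @ [if even m then 1 - x else x]"
    using Suc.IH[of "1 - x"] Suc.prems by simp
  finally show ?case by simp
qed simp

lemma foldr_alt_even: "x \<le> 1 \<Longrightarrow> foldr r (alt x (2 * k)) = (r x \<circ> r (1 - x)) ^^ k"
  by (induction k) auto

text \<open>The trivial action off the flags allows relations between words to be stated as
  equalities of functions on the whole type.\<close>

locale regular_map_action = flag_graph 3 M r for M :: "'a cgraph" and r +
  assumes outside: "u \<notin> flags M \<Longrightarrow> r i u = u"
    and transitive: "u \<in> flags M \<Longrightarrow> v \<in> flags M \<Longrightarrow> \<exists>\<phi> \<in> Aut M. \<phi> u = v"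
    and connected: "u \<in> flags M \<Longrightarrow> flags M \<subseteq> orb r {..<3} u"
    and comm02: "r 0 \<circ> r 2 = r 2 \<circ> r 0"
    and not_bipartite: "\<not> bipartite M"
begin

text \<open>Automorphisms commute with words and are transitive on flags, so one flag determines the
  action of a word: the monodromy group acts regularly.\<close>

lemma foldr_eqI:
  assumes "set w \<subseteq> {..<3}" "set w' \<subseteq> {..<3}" "u \<in> flags M" "foldr r w u = foldr r w' u"
  shows "foldr r w = foldr r w'"
proof
  fix v
  show "foldr r w v = foldr r w' v"
  proof (cases "v \<in> flags M")
    case True
    then obtain \<phi> where \<phi>: "\<phi> \<in> Aut M" "\<phi> u = v" using transitive assms(3) by blast
    have iso: "isomorphism M M \<phi>" using \<phi>(1) by (simp add: Aut_def)
    show ?thesis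
      using isomorphism_foldr[OF flag_graph_axioms flag_graph_axioms iso assms(3,1)]
        isomorphism_foldr[OF flag_graph_axioms flag_graph_axioms iso assms(3,2)] \<phi>(2) assms(4)
      by simp
  next
    case False
    then have "foldr r w v = v" for w by (induction w) (auto simp: outside)
    then show ?thesis by metis
  qed
qed

text \<open>Equal adjacent letters cancel in pairs, which preserves the parity of the
  length.\<close>

lemma alternating_form:
  assumes "set w \<subseteq> {0, 1}"
  obtains x m where "x \<le> 1" "even m = even (length w)" "foldr r w = foldr r (alt x m)"
proof -
  have "\<exists>x m. x \<le> 1 \<and> even m = even (length w) \<and> foldr r w = foldr r (alt x m)"
    using assms
  proof (induction w)
    case Nil
    show ?case by (intro exI[of _ 0]) simp
  next
    case (Cons y w)
    then obtain x m where xm: "x \<le> 1" "even m = even (length w)" "foldr r w = foldr r (alt x m)" by auto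
    have y: "y \<le> 1" using Cons.prems by auto
    show ?case
    proof (cases "m > 0 \<and> x = y")
      case True
      then obtain m' where "m = Suc m'" by (cases m) auto
      then show ?thesis using True xm
        by (intro exI[of _ "1 - y"] exI[of _ m']) (auto simp: fun_eq_iff)
    next
      case False
      then have "alt x m = alt (1 - y) m" using y xm(1) by (cases m; cases x; cases y) auto
      then show ?thesis using y xm
        by (intro exI[of _ y] exI[of _ "Suc m"]) auto
    qed
  qed
  then show ?thesis using that by blast
qed

text \<open>An odd alternating word is a palindrome, hence a conjugate of a single generator, and
  generators fix no flag.\<close>

lemma alt_odd_no_fix:
  assumes "x \<le> 1" "u \<in> flags M"
  shows "foldr r (alt x (Suc (2 * k))) u \<noteq> u"
  using assms
proof (induction k arbitrary: x u)
  case 0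
  then show ?case using no_fix[of x u] by simp
next
  case (Suc k)
  have "alt (1 - x) (Suc (Suc (2 * k))) = alt (1 - x) (Suc (2 * k)) @ [x]"
    using Suc.prems(1) alt_snoc[of "1 - x" "Suc (2 * k)"] by auto
  then have eq: "foldr r (alt x (Suc (2 * Suc k))) u = r x (foldr r (alt (1 - x) (Suc (2 * k))) (r x u))"
    by simp
  have "foldr r (alt (1 - x) (Suc (2 * k))) (r x u) \<noteq> r x u"
    using Suc by (intro Suc.IH) (auto intro: closed)
  then show ?case unfolding eq by (metis invol)
qed

text \<open>
  If a face were fixed by the involution of colour 2, that involution would be a word in the
  dihedral group of the face: an odd word makes the map orientable, and an even one is a
  rotation, whose order contradicts the parity of \<open>p\<close> or \<open>q\<close>.
\<close>

lemma adjacent_face_neq: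
  assumes u: "u \<in> flags M"
    and p: "(r 0 \<circ> r 1) ^^ p = id" and q: "(r 1 \<circ> r 2) ^^ q = id" and odd: "odd p \<or> odd q"
  shows "r 2 u \<notin> orb r {0, 1} u"
proof
  assume "r 2 u \<in> orb r {0, 1} u"
  then obtain w where w: "r 2 u = foldr r w u" "set w \<subseteq> {0, 1}" by (auto simp: orb_def)
  \<comment> \<open>Regularity extends the coincidence at \<open>u\<close> to all flags.\<close>
  have r2: "r 2 = foldr r w"
  proof -
    have "set w \<subseteq> {..<3}" using w(2) by auto
    then show ?thesis using foldr_eqI[of "[2]" w u] w(1) u by simp
  qed
  obtain x m where xm: "x \<le> 1" "even m = even (length w)" "r 2 = foldr r (alt x m)"
    using alternating_form[OF w(2)] r2 by metis
  have inv: "r i \<circ> r i = id" for i by (auto simp: fun_eq_iff)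
  show False
  proof (cases "even m")
    case True
    then obtain k where "m = 2 * k" by blast
    define t where "t = r x \<circ> r (1 - x)"
    have r2t: "r 2 = t ^^ k" using xm \<open>m = 2 * k\<close> by (simp add: foldr_alt_even t_def)
    show False
      using odd
    proof
      assume "odd p"
      have "(r 1 \<circ> r 0) ^^ p = id"
        using funpow_comp_inverse[of "r 1" "r 0" p] p by (auto simp: fun_eq_iff)
      then have "t ^^ p = id" using p xm(1) by (cases x) (auto simp: t_def)
      then have "r 2 ^^ p = id" unfolding r2t
        by (metis funpow_mult id_funpow mult.commute)
      then have "r 2 = id" using funpow_odd_involution[OF inv \<open>odd p\<close>] by metis
      then show False using no_fix[of 2 u] u by simp
    next
      assume "odd q"
      \<comment> \<open>Colour 2 commutes with the rotation \<open>t\<close>, being a power of it,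
        and with colour 0, hence with colour 1. Then \<open>r 1 \<circ> r 2\<close> is an involution
        whose odd power is trivial.\<close>
      have "r 2 \<circ> t = t \<circ> r 2" unfolding r2t by (metis funpow_Suc_right funpow.simps(2))
      then have "r 2 \<circ> r 1 = r 1 \<circ> r 2"
        using comm02 xm(1) by (cases x) (auto simp: t_def fun_eq_iff, (metis invol)+)
      then have "(r 1 \<circ> r 2) \<circ> (r 1 \<circ> r 2) = id" by (auto simp: fun_eq_iff)
      then have "r 1 \<circ> r 2 = id" using funpow_odd_involution \<open>odd q\<close> q by metis
      then have "r 1 u = r 2 u" by (metis comp_apply id_apply invol)
      then show False using r_inj[of 1 2 u] u by simp
    qed
  next
    case False
    have "bipartite M"
    proof (rule bipartiteI[OF u connected[OF u]])
      fix v assume v: "set v \<subseteq> {..<3}" "foldr r v u = u"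
      \<comment> \<open>Replacing each colour 2 by the odd word \<open>w\<close> changes neither the
        action nor the parity, and a closed word in colours 0 and 1 is even.\<close>
      define v' where "v' = concat (map (\<lambda>i. if i = 2 then w else [i]) v)"
      have "set v' \<subseteq> {0, 1} \<and> even (length v') = even (length v) \<and> foldr r v' = foldr r v"
        using v(1) unfolding v'_def
      proof (induction v)
        case (Cons i v)
        then have "i \<in> {0, 1, 2}" by auto
        then show ?case using Cons w(2) xm(2) False by (auto simp: r2[symmetric])
      qed simp
      moreover from this obtain y l where "y \<le> 1" "even l = even (length v')" "foldr r v' = foldr r (alt y l)"
        using alternating_form[of v'] by metis
      ultimately show "even (length v)"
        using alt_odd_no_fix[of y u] u v(2) by (metis oddE Suc_eq_plus1)
    qed
    then show False using not_bipartite by simp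
  qed
qed

text \<open>A connected graph without bipartition has an odd closed word; by regularity it acts
  trivially on all flags.\<close>

lemma odd_word:
  obtains w where "set w \<subseteq> {..<3}" "odd (length w)" "foldr r w = id"
proof -
  have ne: "\<exists>u. u \<in> flags M" using not_bipartite unfolding bipartite_def edges_eq by blast
  then obtain u where u: "u \<in> flags M" by blast
  have "\<not> (\<forall>w. set w \<subseteq> {..<3} \<longrightarrow> foldr r w u = u \<longrightarrow> even (length w))"
    using bipartiteI[OF u connected[OF u]] not_bipartite by blast
  then obtain w where w: "set w \<subseteq> {..<3}" "odd (length w)" "foldr r w u = u" by blast
  then have "foldr r w = foldr r []" using foldr_eqI[of w "[]" u] u by simp
  then show ?thesis using that w by (auto simp: fun_eq_iff)
qed

end

lemma regular_map_action_partner: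
  assumes "regular_map M" "\<not> orientable M"
  shows "regular_map_action M (partner M)"
proof -
  have man: "maniplex 3 M" and orb: "k_orbit 1 M" using assms(1) by (auto simp: regular_map_def)
  interpret flag_graph 3 M "partner M" by (rule flag_graph_partner[OF man])
  show ?thesis
  proof
    show out: "partner M i u = u" if "u \<notin> flags M" for i u
      using that by (rule flag_graph_partner[OF man])
    show "\<exists>\<phi> \<in> Aut M. \<phi> u = v" if uv: "u \<in> flags M" "v \<in> flags M" for u v
    proof -
      let ?R = "{(u, v). u \<in> flags M \<and> v \<in> flags M \<and> (\<exists>\<phi> \<in> Aut M. \<phi> u = v)}"
      have "?R `` {u} \<in> flag_orbits M" "?R `` {v} \<in> flag_orbits M"
        unfolding flag_orbits_def using uv by (auto intro!: quotientI simp only:)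
      then have "?R `` {u} = ?R `` {v}"
      proof -
        obtain X where "flag_orbits M = {X}"
          using orb card_1_singletonE unfolding k_orbit_def by metis
        then show ?thesis using \<open>?R `` {u} \<in> _\<close> \<open>?R `` {v} \<in> _\<close> by simp
      qed
      moreover have "id \<in> Aut M" by (simp add: Aut_def isomorphism_def)
      then have "\<exists>\<phi> \<in> Aut M. \<phi> v = v" by (metis id_apply)
      then have "v \<in> ?R `` {v}" using uv by simp
      ultimately have "v \<in> ?R `` {u}" by (simp only:)
      then show ?thesis by simp
    qed
    show "flags M \<subseteq> orb (partner M) {..<3} u" if "u \<in> flags M" for u
      using man that by (simp add: maniplex_def connected_iff)
    show "\<not> bipartite M" using assms(2) by (simp add: orientable_def)
    have "\<forall>i<3. \<forall>j<3. \<bar>int i - int j\<bar> > 1 \<longrightarrow>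
        (\<forall>C \<in> conn_components (colour_subgraph M {i, j}). cycle_graph 4 C)"
      using man by (simp add: maniplex_def)
    \<comment> \<open>The 4-cycles of colours 0 and 2 are the case \<open>p = 2\<close> of the cycle
      relation, and for involutions this relation is commutation.\<close>
    from this[rule_format, of 0 2]
    have "\<And>C. C \<in> conn_components (colour_subgraph M {0, 2}) \<Longrightarrow> cycle_graph (2 * 2) C" by simp
    then have "((partner M 0 \<circ> partner M 2) ^^ 2) u = u" if "u \<in> flags M" for u
      using that by (intro cycle_relation) auto
    then have "partner M 0 (partner M 2 (partner M 0 (partner M 2 u))) = u" for u
      using out by (cases "u \<in> flags M") (auto simp: numeral_2_eq_2)
    then show "partner M 0 \<circ> partner M 2 = partner M 2 \<circ> partner M 0"
      by (auto simp: fun_eq_iff) (metis invol)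
  qed
qed

lemma (in regular_map_action) type_relation:
  assumes "i < 3" "j < 3" "i \<noteq> j"
    and "\<And>C. C \<in> conn_components (colour_subgraph M {i, j}) \<Longrightarrow> cycle_graph (2 * p) C"
  shows "(r i \<circ> r j) ^^ p = id"
proof
  fix u
  show "((r i \<circ> r j) ^^ p) u = id u"
  proof (cases "u \<in> flags M")
    case False
    then show ?thesis by (induction p) (auto simp: outside)
  qed (use cycle_relation assms in auto)
qed

section \<open>Maniplexes over the four vertices of a square\<close>

lemma foldr_concat_replicate: "foldr r (concat (replicate k w)) = foldr r w ^^ k"
  by (induction k) auto

text \<open>A monoid by definition, and a group once the generators are involutions, since reversing
  a word then inverts it.\<close>

definition gen :: "(nat \<Rightarrow> 's \<Rightarrow> 's) \<Rightarrow> nat set \<Rightarrow> ('s \<Rightarrow> 's) set" where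
  "gen \<rho> I = {foldr \<rho> w | w. set w \<subseteq> I}"

lemma gen_comp: "g \<in> gen \<rho> I \<Longrightarrow> h \<in> gen \<rho> I \<Longrightarrow> g \<circ> h \<in> gen \<rho> I"
proof -
  assume "g \<in> gen \<rho> I" "h \<in> gen \<rho> I"
  then obtain v w where "g = foldr \<rho> v" "h = foldr \<rho> w" "set v \<subseteq> I" "set w \<subseteq> I" by (auto simp: gen_def)
  then have "g \<circ> h = foldr \<rho> (v @ w)" "set (v @ w) \<subseteq> I" by auto
  then show ?thesis unfolding gen_def by blast
qed

lemma id_gen: "id \<in> gen \<rho> I"
proof -
  have "foldr \<rho> [] = id" by auto
  then show ?thesis unfolding gen_def by (metis (mono_tags, lifting) empty_set empty_subsetI mem_Collect_eq)
qed

lemma gen_generator: "i \<in> I \<Longrightarrow> \<rho> i \<in> gen \<rho> I"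
proof -
  assume "i \<in> I"
  then have "\<rho> i = foldr \<rho> [i]" "set [i] \<subseteq> I" by auto
  then show ?thesis unfolding gen_def by blast
qed

lemma gen_inverse:
  assumes "\<And>i s. \<rho> i (\<rho> i s) = s" "g \<in> gen \<rho> I"
  obtains h where "h \<in> gen \<rho> I" "g \<circ> h = id" "h \<circ> g = id"
proof -
  obtain w where w: "g = foldr \<rho> w" "set w \<subseteq> I" using assms(2) by (auto simp: gen_def)
  have "foldr \<rho> (rev w) \<circ> g = id"
    using foldr_rev_cancel[of \<rho> w] assms(1) w(1) by (auto simp: fun_eq_iff)
  moreover have "g \<circ> foldr \<rho> (rev w) = id"
    using foldr_rev_cancel[of \<rho> "rev w"] assms(1) w(1) by (auto simp: fun_eq_iff)
  moreover have "foldr \<rho> (rev w) \<in> gen \<rho> I" unfolding gen_def using w(2) by fastforce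
  ultimately show ?thesis using that by blast
qed

text \<open>
  The vertices of a square, numbered cyclically as \<open>(h, l) = 2 h + l\<close>: colours 0 and 2 act by
  \<open>x \<mapsto> 1 - x\<close>, colour 1 by \<open>x \<mapsto> - x\<close>.
\<close>

definition sq :: "nat \<Rightarrow> bool \<times> bool \<Rightarrow> bool \<times> bool" where
  "sq i x = (if i = 1 then (fst x \<noteq> snd x, snd x)
     else if i = 0 \<or> i = 2 then (fst x, \<not> snd x) else x)"

text \<open>In the cyclic numbering, \<open>rot True\<close> adds 1 and \<open>rot False\<close>
  subtracts 1 modulo 4.\<close>

definition rot :: "bool \<Rightarrow> bool \<times> bool \<Rightarrow> bool \<times> bool" where
  "rot b x = ((fst x \<noteq> snd x) = b, \<not> snd x)"

lemma sq_invol: "sq i (sq i x) = x"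
  by (auto simp: sq_def prod_eq_iff)

lemma sq_comm: "\<bar>int i - int j\<bar> > 1 \<Longrightarrow> sq i (sq j x) = sq j (sq i x)"
  by (auto simp: sq_def)

lemma rot_cancel: "b \<noteq> b' \<Longrightarrow> rot b' (rot b x) = x"
  by (auto simp: rot_def prod_eq_iff)

text \<open>Colours 0, 1, 2 act as reflections, which invert rotations; all other colours act
  trivially.\<close>

lemma sq_rot: "sq i (rot b x) = rot (b = (3 \<le> i)) (sq i x)"
  by (auto simp: sq_def rot_def prod_eq_iff)

lemma rot_transitive: "\<exists>m. (rot True ^^ m) x = y"
proof -
  have "y \<in> {(rot True ^^ 0) x, (rot True ^^ 1) x, (rot True ^^ 2) x, (rot True ^^ 3) x}"
    by (cases x; cases y) (auto simp: rot_def numeral_eq_Suc)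
  then have "\<exists>m \<in> {0, 1, 2, 3}. (rot True ^^ m) x = y" by (simp only: insert_iff empty_iff bex_simps) metis
  then show ?thesis by blast
qed

section \<open>Automorphisms of flag graphs\<close>

context flag_graph
begin

lemma Aut_iff:
  "\<phi> \<in> Aut G \<longleftrightarrow> bij_betw \<phi> (flags G) (flags G) \<and> (\<forall>u \<in> flags G. \<forall>i<n. \<phi> (r i u) = r i (\<phi> u))"
  by (simp add: Aut_def isomorphism_iff[OF flag_graph_axioms flag_graph_axioms])

lemma Aut_foldr:
  "\<phi> \<in> Aut G \<Longrightarrow> u \<in> flags G \<Longrightarrow> set w \<subseteq> {..<n} \<Longrightarrow> \<phi> (foldr r w u) = foldr r w (\<phi> u)"
  using isomorphism_foldr[OF flag_graph_axioms flag_graph_axioms] by (simp add: Aut_def)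

lemma Aut_orb:
  assumes "\<phi> \<in> Aut G" "u \<in> flags G" "I \<subseteq> {..<n}"
  shows "\<phi> ` orb r I u = orb r I (\<phi> u)"
  unfolding orb_def using Aut_foldr[OF assms(1,2)] assms(3)
  by (auto simp: image_iff) (metis subset_trans)+

end

text \<open>Via \<open>lam\<close> a flag is a group element with a vertex of the square; colours
  act by left multiplication and by \<open>sq\<close>. The two words act on the square alone. Up to
  a constant, \<open>par\<close> is the parity of the number of letters of colour at least 3, as a
  function of the group element.\<close>

locale square_cover = flag_graph n N r for n and N :: "'b cgraph" and r +
  fixes \<rho> :: "nat \<Rightarrow> 's \<Rightarrow> 's" and lam :: "'b \<Rightarrow> ('s \<Rightarrow> 's) \<times> bool \<times> bool"
    and par :: "('s \<Rightarrow> 's) \<Rightarrow> bool"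
  assumes n3: "3 \<le> n"
    and lam: "bij_betw lam (flags N) (gen \<rho> {..<n} \<times> UNIV)"
    and lam_r: "i < n \<Longrightarrow> u \<in> flags N \<Longrightarrow> lam (r i u) = (\<rho> i \<circ> fst (lam u), sq i (snd (lam u)))"
    and \<rho>_invol: "\<rho> i (\<rho> i s) = s"
    and \<rho>_comm: "\<bar>int i - int j\<bar> > 1 \<Longrightarrow> \<rho> i \<circ> \<rho> j = \<rho> j \<circ> \<rho> i"
    and rot_word: "\<exists>w. set w \<subseteq> {..<3} \<and> foldr \<rho> w = id \<and> foldr sq w = rot True"
    and reflection_word: "\<exists>w. set w \<subseteq> {..<3} \<and> odd (length w) \<and> foldr \<rho> w = id \<and> foldr sq w = sq 1"
    and par: "i < n \<Longrightarrow> g \<in> gen \<rho> {..<n} \<Longrightarrow> par (\<rho> i \<circ> g) \<longleftrightarrow> par g \<noteq> (3 \<le> i)"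
begin

definition unlam :: "('s \<Rightarrow> 's) \<times> bool \<times> bool \<Rightarrow> 'b" where
  "unlam = inv_into (flags N) lam"

lemma lam_gen: "u \<in> flags N \<Longrightarrow> fst (lam u) \<in> gen \<rho> {..<n}"
  using bij_betwE[OF lam] by (metis mem_Times_iff)

lemma unlam: "g \<in> gen \<rho> {..<n} \<Longrightarrow> unlam (g, x) \<in> flags N"
  "g \<in> gen \<rho> {..<n} \<Longrightarrow> lam (unlam (g, x)) = (g, x)"
  using lam unfolding bij_betw_def unlam_def by (auto intro!: inv_into_into f_inv_into_f)

lemma unlam_lam: "u \<in> flags N \<Longrightarrow> unlam (lam u) = u"
  using lam by (simp add: unlam_def bij_betw_def)

lemma lam_inj: "u \<in> flags N \<Longrightarrow> v \<in> flags N \<Longrightarrow> lam u = lam v \<Longrightarrow> u = v"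
  using unlam_lam by metis

lemma flags_nonempty: "flags N \<noteq> {}"
  using unlam(1)[OF id_gen] by auto

lemma lam_foldr:
  "set w \<subseteq> {..<n} \<Longrightarrow> u \<in> flags N \<Longrightarrow>
    lam (foldr r w u) = (foldr \<rho> w \<circ> fst (lam u), foldr sq w (snd (lam u)))"
  by (induction w) (auto simp: lam_r foldr_closed)

text \<open>Some word adjusts the group coordinate; powers of the rotation word then reach every
  vertex without disturbing it.\<close>

lemma orb_iff:
  assumes I: "{..<3} \<subseteq> I" "I \<subseteq> {..<n}" and u: "u \<in> flags N"
  shows "v \<in> orb r I u \<longleftrightarrow> v \<in> flags N \<and> (\<exists>k \<in> gen \<rho> I. fst (lam v) = k \<circ> fst (lam u))"
proof
  assume "v \<in> orb r I u"
  then obtain w where "v = foldr r w u" "set w \<subseteq> I" by (auto simp: orb_def)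
  then show "v \<in> flags N \<and> (\<exists>k \<in> gen \<rho> I. fst (lam v) = k \<circ> fst (lam u))"
    using lam_foldr[of w u] I(2) u foldr_closed[of w u] by (auto simp: gen_def)
next
  assume v: "v \<in> flags N \<and> (\<exists>k \<in> gen \<rho> I. fst (lam v) = k \<circ> fst (lam u))"
  then obtain w where w: "fst (lam v) = foldr \<rho> w \<circ> fst (lam u)" "set w \<subseteq> I" by (auto simp: gen_def)
  obtain t where t: "set t \<subseteq> {..<3}" "foldr \<rho> t = id" "foldr sq t = rot True" using rot_word by blast
  obtain m where m: "(rot True ^^ m) (foldr sq w (snd (lam u))) = snd (lam v)"
    using rot_transitive by blast
  define w' where "w' = concat (replicate m t) @ w"
  have "set w' \<subseteq> I" using t(1) w(2) I(1) by (auto simp: w'_def)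
  moreover have "foldr \<rho> w' = foldr \<rho> w"
    by (rule ext) (simp add: w'_def foldr_concat_replicate t(2))
  moreover have "foldr sq w' (snd (lam u)) = snd (lam v)"
    using m by (simp add: w'_def foldr_concat_replicate t(3))
  ultimately have "lam (foldr r w' u) = lam v"
    using lam_foldr[of w' u] I(2) u w(1) by (simp add: prod_eq_iff)
  moreover have "foldr r w' u \<in> flags N"
    using foldr_closed[of w' u] u I(2) \<open>set w' \<subseteq> I\<close> by blast
  ultimately have "v = foldr r w' u" using lam_inj v by metis
  then show "v \<in> orb r I u" using \<open>set w' \<subseteq> I\<close> by (auto simp: orb_def)
qed

lemma maniplex: "maniplex n N"
proof (rule maniplexI[OF flags_nonempty])
  fix u assume u: "u \<in> flags N"
  show "flags N \<subseteq> orb r {..<n} u"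
  proof
    fix v assume v: "v \<in> flags N"
    obtain h where h: "h \<in> gen \<rho> {..<n}" "h \<circ> fst (lam u) = id"
      using gen_inverse[OF \<rho>_invol lam_gen[OF u]] by metis
    then have "fst (lam v) = (fst (lam v) \<circ> h) \<circ> fst (lam u)" by (simp add: comp_assoc)
    moreover have "fst (lam v) \<circ> h \<in> gen \<rho> {..<n}" using gen_comp lam_gen v h by blast
    ultimately show "v \<in> orb r {..<n} u" using orb_iff[OF _ _ u] n3 v by auto
  qed
next
  fix i j u assume ij: "i < n" "j < n" "\<bar>int i - int j\<bar> > 1" and u: "u \<in> flags N"
  have "lam (r i (r j u)) = lam (r j (r i u))"
  proof -
    have "\<rho> i \<circ> (\<rho> j \<circ> g) = \<rho> j \<circ> (\<rho> i \<circ> g)" for g :: "'s \<Rightarrow> 's"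
      using \<rho>_comm[OF ij(3)] by (metis comp_assoc)
    then show ?thesis using ij u closed sq_comm[OF ij(3)] by (simp add: lam_r)
  qed
  then show "r i (r j u) = r j (r i u)" 
    by (intro lam_inj[of "r i (r j u)"] closed ij u)
qed

text \<open>The odd reflection word is trivial on the group and fixes vertex 0 of the square, so it
  closes up at a flag over that vertex.\<close>

lemma not_orientable: "\<not> orientable N"
proof
  assume "orientable N"
  obtain w where w: "set w \<subseteq> {..<3}" "odd (length w)" "foldr \<rho> w = id" "foldr sq w = sq 1"
    using reflection_word by blast
  define u where "u = unlam (id, (False, False))"
  have u: "u \<in> flags N" "lam u = (id, (False, False))" unfolding u_def using unlam id_gen by blast+
  have wn: "set w \<subseteq> {..<n}" using w(1) n3 by auto
  have "lam (foldr r w u) = lam u" using lam_foldr[OF wn u(1)] u(2) w by (simp add: sq_def)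
  then have "foldr r w u = u" using lam_inj foldr_closed wn u(1) by blast
  then show False using bipartite_foldr \<open>orientable N\<close> wn u(1) w(2) by (auto simp: orientable_def)
qed

text \<open>Right multiplication commutes with the left action of the colours, and adding 2 is
  central in the dihedral group of the square. Together they join any two flags whose vertices have
  equal parity.\<close>

lemma automorphism_exists:
  assumes uv: "u \<in> flags N" "v \<in> flags N" and eq: "snd (snd (lam u)) = snd (snd (lam v))"
  shows "\<exists>\<phi> \<in> Aut N. \<phi> u = v"
proof -
  obtain h where h: "h \<in> gen \<rho> {..<n}" "fst (lam u) \<circ> h = id" "h \<circ> fst (lam u) = id"
    using gen_inverse[OF \<rho>_invol lam_gen[OF uv(1)]] by metis
  define k where "k = h \<circ> fst (lam v)"
  have k: "k \<in> gen \<rho> {..<n}" unfolding k_def using h uv lam_gen gen_comp by blast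
  obtain k' where k': "k' \<in> gen \<rho> {..<n}" "k \<circ> k' = id" "k' \<circ> k = id"
    using gen_inverse[OF \<rho>_invol k] by metis
  \<comment> \<open>Tells whether 2 has to be added to the vertex.\<close>
  define b where "b = (fst (snd (lam u)) \<noteq> fst (snd (lam v)))"
  define T where "T g z = unlam (fst (lam z) \<circ> g, (fst (snd (lam z)) \<noteq> b, snd (snd (lam z))))"
    for g and z
  have T: "T g z \<in> flags N"
    "lam (T g z) = (fst (lam z) \<circ> g, (fst (snd (lam z)) \<noteq> b, snd (snd (lam z))))"
    if "g \<in> gen \<rho> {..<n}" "z \<in> flags N" for g z
    unfolding T_def using unlam gen_comp lam_gen that by blast+
  have "T k u = v"
  proof (rule lam_inj)
    show "lam (T k u) = lam v"
      using eq T(2)[OF k uv(1)] h(2)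
      by (auto simp: prod_eq_iff b_def k_def comp_assoc[symmetric])
  qed (use T k uv in auto)
  moreover have "T k \<in> Aut N"
    unfolding Aut_iff
  proof (intro conjI ballI allI impI)
    show "bij_betw (T k) (flags N) (flags N)"
    proof (rule bij_betw_byWitness[where f' = "T k'"])
      have "lam (T k' (T k z)) = lam z" "lam (T k (T k' z)) = lam z"
        if "z \<in> flags N" for z
        using that k k' by (auto simp: T prod_eq_iff comp_assoc)
      then show "\<forall>z \<in> flags N. T k' (T k z) = z" "\<forall>z \<in> flags N. T k (T k' z) = z"
        by (auto intro!: lam_inj T(1) k k'(1))
    qed (use T k k' in auto)
    fix z i assume z: "z \<in> flags N" "i < n"
    show "T k (r i z) = r i (T k z)"
    proof (rule lam_inj)
      show "lam (T k (r i z)) = lam (r i (T k z))"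
        using z k by (simp add: T lam_r closed comp_assoc) (auto simp: sq_def)
    qed (use T k z closed in auto)
  qed
  ultimately show ?thesis by blast
qed

text \<open>The reflection word fixes precisely the flags with even vertex, and automorphisms
  preserve the set of flags fixed by a word.\<close>

lemma automorphism_level:
  assumes \<phi>: "\<phi> \<in> Aut N" and u: "u \<in> flags N"
  shows "snd (snd (lam (\<phi> u))) = snd (snd (lam u))"
proof -
  obtain w where w: "set w \<subseteq> {..<3}" "foldr \<rho> w = id" "foldr sq w = sq 1"
    using reflection_word by blast
  have wn: "set w \<subseteq> {..<n}" using w(1) n3 by auto
  have *: "foldr r w v = v \<longleftrightarrow> \<not> snd (snd (lam v))" if v: "v \<in> flags N" for v
  proof -
    have "foldr r w v = v \<longleftrightarrow> lam (foldr r w v) = lam v"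
      using lam_inj foldr_closed wn v by metis
    then show ?thesis using lam_foldr[OF wn v] w by (auto simp: prod_eq_iff sq_def)
  qed
  have bij: "bij_betw \<phi> (flags N) (flags N)" using \<phi> by (simp add: Aut_iff)
  have "foldr r w (\<phi> u) = \<phi> u \<longleftrightarrow> \<phi> (foldr r w u) = \<phi> u"
    using Aut_foldr[OF \<phi> u wn] by simp
  also have "\<dots> \<longleftrightarrow> foldr r w u = u"
    using bij u foldr_closed[OF wn u] by (auto simp: bij_betw_def inj_on_def)
  finally show ?thesis using *[of u] *[of "\<phi> u"] u bij by (auto simp: bij_betw_def)
qed

lemma two_orbit: "k_orbit 2 N"
proof -
  define A where "A b = {u \<in> flags N. snd (snd (lam u)) = b}" for b
  have "{(u, v). u \<in> flags N \<and> v \<in> flags N \<and> (\<exists>\<phi> \<in> Aut N. \<phi> u = v)} `` {u} = A (snd (snd (lam u)))"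
    if "u \<in> flags N" for u
    using that automorphism_exists automorphism_level by (fastforce simp: A_def)
  then have "flag_orbits N = (\<lambda>u. A (snd (snd (lam u)))) ` flags N"
    by (auto simp: flag_orbits_def quotient_def)
  also have "\<dots> = A ` UNIV"
  proof -
    have "b \<in> (\<lambda>u. snd (snd (lam u))) ` flags N" for b
      using unlam[OF id_gen, of "(b, b)"] by force
    then have "(\<lambda>u. snd (snd (lam u))) ` flags N = UNIV" by auto
    then show ?thesis by (metis image_image)
  qed
  finally have orbits: "flag_orbits N = {A True, A False}" by (simp add: UNIV_bool insert_commute)
  moreover have "A True \<noteq> A False"
    using unlam[OF id_gen, of "(True, True)"] by (auto simp: A_def)
  ultimately show ?thesis by (simp add: k_orbit_def)
qed

text \<open>Colour 0 or 2 survives the deletion of colour \<open>i\<close> and changes the parity of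
  the vertex, so every face meets both flag orbits.\<close>

lemma fully_transitive: "fully_transitive n N"
  unfolding fully_transitive_def
proof (intro allI impI ballI)
  fix i F F' assume i: "i < n" and F: "F \<in> faces N i" "F' \<in> faces N i"
  define I where "I = - {i} \<inter> {..<n}"
  have In: "I \<subseteq> {..<n}" by (auto simp: I_def)
  obtain u v where uv: "u \<in> flags N" "v \<in> flags N" "flags F = orb r I u" "flags F' = orb r I v"
    using F unfolding faces_def conn_components_iff I_def by (auto simp: induced_subgraph_def)
  define c :: nat where "c = (if i = 0 then 2 else 0)"
  have c: "c \<in> I" using n3 by (auto simp: c_def I_def)
  obtain v' where v': "v' \<in> flags N" "v' \<in> orb r I v" "snd (snd (lam u)) = snd (snd (lam v'))"
  proof (cases "snd (snd (lam u)) = snd (snd (lam v))")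
    case True
    then show ?thesis using that[of v] uv(2) orb_refl[of v r I] by simp
  next
    case False
    have "r c v \<in> orb r I v" using orb_step[OF orb_refl c] .
    moreover have "snd (snd (lam (r c v))) = (\<not> snd (snd (lam v)))"
      using c In uv(2) by (subst lam_r) (auto simp: sq_def c_def)
    ultimately show ?thesis using that[of "r c v"] False closed c In uv(2) by auto
  qed
  then obtain \<phi> where "\<phi> \<in> Aut N" "\<phi> u = v'" using automorphism_exists[of u v'] uv by blast
  then have "\<phi> ` flags F = orb r I v'" using Aut_orb uv In by simp
  also have "\<dots> = flags F'" using orb_eq[of r v' I v] v' uv by simp
  finally show "\<exists>\<phi> \<in> Aut N. \<phi> ` flags F = flags F'" using \<open>\<phi> \<in> Aut N\<close> by blast
qed

text \<open>
  With \<open>j\<close> corrected by \<open>par\<close>, the pairs \<open>(x, j)\<close> of a vertex and a layer of the double cover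
  carry the regular action of the dihedral group of order 8, and \<open>(x, j) \<mapsto> (x \<plusminus> 1, j)\<close>, the
  sign depending on \<open>j\<close>, commutes with it.
\<close>

lemma unstable: "unstable N"
proof -
  \<comment> \<open>The layer corrected by \<open>par\<close>; it selects the direction of the
    rotation.\<close>
  define s where "s u j = ((j = 1) = par (fst (lam u)))" for u and j :: bit
  \<comment> \<open>The parameter \<open>c\<close> reverses the direction, so that
    \<open>\<psi> False\<close> is inverse to \<open>\<psi> True\<close>.\<close>
  define \<psi> where "\<psi> c z = (unlam (fst (lam (fst z)), rot (s (fst z) (snd z) = c) (snd (lam (fst z)))), snd z)"
    for c and z :: "'b \<times> bit"
  have \<psi>: "fst (\<psi> c (u, j)) \<in> flags N" "snd (\<psi> c (u, j)) = j"
    "lam (fst (\<psi> c (u, j))) = (fst (lam u), rot (s u j = c) (snd (lam u)))" if "u \<in> flags N" for c u j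
    unfolding \<psi>_def using unlam lam_gen that by auto
  have fl: "flags (double_cover N) = flags N \<times> UNIV" by (simp add: double_cover_def)
  have one: "(j + 1 = 1) = (j \<noteq> 1)" for j :: bit by (cases j) auto
  have "\<psi> True \<in> Aut (double_cover N)"
    unfolding flag_graph.Aut_iff[OF flag_graph_double_cover] fl
  proof (intro conjI ballI allI impI)
    have inv: "\<psi> (\<not> c) (\<psi> c z) = z" if z: "z \<in> flags N \<times> UNIV" for c z
    proof -
      obtain u j where uj: "z = (u, j)" "u \<in> flags N" using z by auto
      define v where "v = fst (\<psi> c z)"
      have v: "\<psi> c z = (v, j)" "v \<in> flags N" "lam v = (fst (lam u), rot (s u j = c) (snd (lam u)))"
        using \<psi>[OF uj(2), of c j] by (auto simp: v_def uj(1) prod_eq_iff)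
      have "s v j = s u j" using v(3) by (simp add: s_def)
      then have "lam (fst (\<psi> (\<not> c) (v, j))) = lam u"
        using \<psi>(3)[OF v(2), of "\<not> c" j] v(3) \<open>s v j = s u j\<close>
          rot_cancel[of "s u j = c" "s u j = (\<not> c)"] by (auto simp: prod_eq_iff)
      then have "fst (\<psi> (\<not> c) (v, j)) = u" using lam_inj \<psi>(1)[OF v(2)] uj(2) by blast
      then show ?thesis using v(1) uj(1) \<psi>(2)[OF v(2), of "\<not> c" j] by (metis prod.collapse)
    qed
    show "bij_betw (\<psi> True) (flags N \<times> UNIV) (flags N \<times> UNIV)"
    proof (rule bij_betw_byWitness[where f' = "\<psi> False"])
      have "\<psi> c z \<in> flags N \<times> UNIV" if "z \<in> flags N \<times> UNIV" for c z
        using \<psi>(1)[of "fst z" c "snd z"] that by (simp add: mem_Times_iff)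
      then show "\<psi> True ` (flags N \<times> UNIV) \<subseteq> flags N \<times> UNIV"
        "\<psi> False ` (flags N \<times> UNIV) \<subseteq> flags N \<times> UNIV"
        by blast+
      show "\<forall>z \<in> flags N \<times> UNIV. \<psi> False (\<psi> True z) = z"
        "\<forall>z \<in> flags N \<times> UNIV. \<psi> True (\<psi> False z) = z"
        using inv[of _ True] inv[of _ False] by simp_all
    qed
  next
    fix z i assume z: "z \<in> flags N \<times> (UNIV :: bit set)" and i: "i < n"
    obtain u j where uj: "z = (u, j)" "u \<in> flags N" using z by auto
    define v where "v = fst (\<psi> True z)"
    have v: "\<psi> True z = (v, j)" "v \<in> flags N" "lam v = (fst (lam u), rot (s u j) (snd (lam u)))"
      using \<psi>[OF uj(2), of True j] by (auto simp: v_def uj(1) prod_eq_iff)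
    \<comment> \<open>A colour below 3 changes the layer but not \<open>par\<close>, so the
      direction reverses, as \<open>sq_rot\<close> demands; a colour from 3 on changes both and
      keeps the direction.\<close>
    have "s (r i u) (j + 1) = (s u j = (3 \<le> i))"
      using par[OF i lam_gen[OF uj(2)]] lam_r[OF i uj(2)] by (auto simp: s_def one)
    then have "lam (fst (\<psi> True (r i u, j + 1))) = lam (r i v)"
      using \<psi>(3)[OF closed[OF i uj(2)], of True "j + 1"] v(3) lam_r i uj(2) v(2)
      by (simp add: sq_rot)
    then have "fst (\<psi> True (r i u, j + 1)) = r i v"
      using lam_inj \<psi>(1)[OF closed[OF i uj(2)]] closed[OF i v(2)] by blast
    then have "\<psi> True (r i u, j + 1) = (r i v, j + 1)"
      using \<psi>(2)[OF closed[OF i uj(2)], of True "j + 1"] by (metis prod.collapse)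
    then show "\<psi> True ((\<lambda>(u, j). (r i u, j + 1)) z) = (\<lambda>(u, j). (r i u, j + 1)) (\<psi> True z)"
      unfolding v(1) by (simp only: uj(1) case_prod_conv)
  qed
  \<comment> \<open>An expected automorphism moves the two copies of a flag alike, whereas
    \<open>\<psi> True\<close> rotates them in opposite directions.\<close>
  moreover have "\<not> expected N (\<psi> True)"
  proof
    assume "expected N (\<psi> True)"
    then obtain \<phi> a where "\<And>u j. u \<in> flags N \<Longrightarrow> \<psi> True (u, j) = (\<phi> u, j + a)"
      by (auto simp: expected_def)
    moreover obtain u where u: "u \<in> flags N" using flags_nonempty by blast
    ultimately have "lam (fst (\<psi> True (u, 0))) = lam (fst (\<psi> True (u, 1)))" by simp
    then show False using \<psi>(3)[OF u] by (auto simp: s_def rot_def)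
  qed
  ultimately show ?thesis using not_orientable by (auto simp: unstable_def stable_def)
qed

end

text \<open>The group coordinates of a component form a coset of the subgroup of colours 0, 1, 2.
  Right multiplication by \<open>h\<close> translates it to that subgroup and commutes with the
  colours.\<close>

lemma component_isomorphic:
  assumes "square_cover n N r \<rho> lam par" "square_cover 3 N' r' \<rho>' lam' par'"
    and agree: "\<And>i. i < 3 \<Longrightarrow> \<rho> i = \<rho>' i"
    and F: "F \<in> conn_components (colour_subgraph N {0, 1, 2})"
  shows "isomorphic F N'"
proof -
  interpret N: square_cover n N r \<rho> lam par by fact
  interpret N': square_cover 3 N' r' \<rho>' lam' par' by fact
  have I: "{0, 1, 2} = {..<3::nat}" by auto
  have In: "{..<3} \<inter> {..<n} = {..<3}" using N.n3 by auto
  obtain u where u: "u \<in> flags N" "F = induced_subgraph (colour_subgraph N {..<3}) (orb r {..<3} u)"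
    using F unfolding I N.conn_components_iff In by blast
  have fg: "flag_graph 3 F r" unfolding u(2) by (rule N.flag_graph_component[OF N.n3 u(1)])
  have fl: "flags F = orb r {..<3} u" by (simp add: u(2) induced_subgraph_def)
  have gen_eq: "gen \<rho> {..<3} = gen \<rho>' {..<3}"
  proof -
    have "foldr \<rho> w = foldr \<rho>' w" if "set w \<subseteq> {..<3}" for w
      using that by (induction w) (auto simp: agree)
    then show ?thesis unfolding gen_def by (metis (no_types, lifting))
  qed
  have sub: "gen \<rho> {..<3} \<subseteq> gen \<rho> {..<n}" using N.n3 unfolding gen_def by fastforce
  obtain h where h: "h \<in> gen \<rho> {..<n}" "fst (lam u) \<circ> h = id" "h \<circ> fst (lam u) = id"
    using gen_inverse[OF N.\<rho>_invol N.lam_gen[OF u(1)]] by metis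
  have mem: "v \<in> flags F \<longleftrightarrow> v \<in> flags N \<and> fst (lam v) \<circ> h \<in> gen \<rho> {..<3}" for v
  proof -
    have "(\<exists>k \<in> gen \<rho> {..<3}. fst (lam v) = k \<circ> fst (lam u)) \<longleftrightarrow> fst (lam v) \<circ> h \<in> gen \<rho> {..<3}"
      using h(2,3) by (metis comp_assoc comp_id)
    then show ?thesis unfolding fl using N.orb_iff[of "{..<3}" u v] N.n3 u(1) by auto
  qed
  define f where "f v = N'.unlam (fst (lam v) \<circ> h, snd (lam v))" for v
  have f: "f v \<in> flags N'" "lam' (f v) = (fst (lam v) \<circ> h, snd (lam v))" if "v \<in> flags F" for v
    unfolding f_def using N'.unlam gen_eq mem that by auto
  have "isomorphism F N' f"
    unfolding isomorphism_iff[OF fg N'.flag_graph_axioms]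
  proof (intro conjI ballI allI impI)
    have "inj_on f (flags F)"
    proof (rule inj_onI)
      fix v v' assume v: "v \<in> flags F" "v' \<in> flags F" "f v = f v'"
      then have "fst (lam v) \<circ> h = fst (lam v') \<circ> h" "snd (lam v) = snd (lam v')"
        using f by (metis prod.inject)+
      then have "lam v = lam v'" using h(3) by (metis comp_assoc comp_id prod_eq_iff)
      then show "v = v'" using N.lam_inj v mem by blast
    qed
    moreover have "f ` flags F = flags N'"
    proof (intro equalityI subsetI)
      fix z assume z: "z \<in> flags N'"
      have k: "fst (lam' z) \<in> gen \<rho> {..<3}" using N'.lam_gen[OF z] gen_eq by simp
      define v where "v = N.unlam (fst (lam' z) \<circ> fst (lam u), snd (lam' z))"
      have "fst (lam' z) \<circ> fst (lam u) \<in> gen \<rho> {..<n}"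
        using k sub N.lam_gen[OF u(1)] gen_comp by blast
      then have v: "v \<in> flags N" "lam v = (fst (lam' z) \<circ> fst (lam u), snd (lam' z))"
        unfolding v_def using N.unlam by blast+
      have "v \<in> flags F" using v k h(2) by (simp add: mem comp_assoc)
      moreover have "lam' (f v) = lam' z" using f(2)[OF calculation] v(2) h(2) by (simp add: comp_assoc)
      ultimately show "z \<in> f ` flags F" using N'.lam_inj f(1) z by blast
    qed (use f in auto)
    ultimately show "bij_betw f (flags F) (flags N')" by (simp add: bij_betw_def)
  next
    fix v and i :: nat assume v: "v \<in> flags F" "i < 3"
    have vN: "v \<in> flags N" "i < n" using v mem N.n3 by auto
    have rv: "r i v \<in> flags F" using flag_graph.closed[OF fg v(2,1)] .
    show "f (r i v) = r' i (f v)"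
    proof (rule N'.lam_inj)
      show "lam' (f (r i v)) = lam' (r' i (f v))"
        using f[OF rv] f[OF v(1)] N.lam_r[OF vN(2,1)] N'.lam_r[OF v(2) f(1)[OF v(1)]] agree[OF v(2)]
        by (simp add: comp_assoc)
    qed (use f rv v N'.closed in auto)
  qed
  then show ?thesis by (auto simp: isomorphic_def)
qed

section \<open>The involutions generating the covers\<close>

text \<open>The group is countable because words are, so natural numbers can serve as flags.
  Distinct non-trivial generators exclude multiple edges and loops, as left multiplication is
  free.\<close>

lemma exists_square_cover:
  fixes \<rho> :: "nat \<Rightarrow> 's \<Rightarrow> 's"
  assumes "3 \<le> n" and invol: "\<And>i s. \<rho> i (\<rho> i s) = s"
    and "\<And>i j. \<bar>int i - int j\<bar> > 1 \<Longrightarrow> \<rho> i \<circ> \<rho> j = \<rho> j \<circ> \<rho> i"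
    and inj: "inj_on \<rho> {..<n}" and not_id: "\<And>i. i < n \<Longrightarrow> \<rho> i \<noteq> id"
    and "\<exists>w. set w \<subseteq> {..<3} \<and> foldr \<rho> w = id \<and> foldr sq w = rot True"
    and "\<exists>w. set w \<subseteq> {..<3} \<and> odd (length w) \<and> foldr \<rho> w = id \<and> foldr sq w = sq 1"
    and "\<And>i g. i < n \<Longrightarrow> g \<in> gen \<rho> {..<n} \<Longrightarrow> par (\<rho> i \<circ> g) \<longleftrightarrow> par g \<noteq> (3 \<le> i)"
  shows "\<exists>(N :: nat cgraph) r lam. square_cover n N r \<rho> lam par"
proof -
  define A :: "(('s \<Rightarrow> 's) \<times> bool \<times> bool) set" where "A = gen \<rho> {..<n} \<times> UNIV"
  define lam where "lam = from_nat_into A"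
  define code where "code = to_nat_on A"
  define X where "X = code ` A"
  \<comment> \<open>The identity elsewhere, which gives the involution law on all natural numbers
    and colours.\<close>
  define r where "r i v = (if v \<in> X \<and> i < n then code (\<rho> i \<circ> fst (lam v), sq i (snd (lam v))) else v)" for i v
  have "countable A"
  proof -
    have "gen \<rho> {..<n} \<subseteq> range (foldr \<rho>)" by (auto simp: gen_def)
    then have "countable (gen \<rho> {..<n})" by (rule countable_subset) simp
    then show ?thesis by (simp add: A_def)
  qed
  then have lam_code: "lam (code a) = a" if "a \<in> A" for a
    using that by (simp add: lam_def code_def)
  have code: "code a \<in> X" if "a \<in> A" for a using that by (simp add: X_def)
  have lam_A: "lam v \<in> A" and code_lam: "code (lam v) = v" if "v \<in> X" for v
    using that lam_code by (auto simp: X_def)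
  have step_A: "(\<rho> i \<circ> fst (lam v), sq i (snd (lam v))) \<in> A" if "v \<in> X" "i < n" for i v
    using lam_A[OF that(1)] that(2) gen_comp[OF gen_generator[of i "{..<n}" \<rho>]] by (auto simp: A_def)
  have closed: "r i v \<in> X" if "v \<in> X" "i < n" for i v
    using that step_A code by (simp add: r_def)
  have lam_r: "lam (r i v) = (\<rho> i \<circ> fst (lam v), sq i (snd (lam v)))" if "v \<in> X" "i < n" for i v
    using that step_A lam_code by (simp add: r_def)
  have rr: "r i (r i v) = v" for i v
  proof (cases "v \<in> X \<and> i < n")
    case True
    moreover have "\<rho> i \<circ> (\<rho> i \<circ> g) = g" for g :: "'s \<Rightarrow> 's" using invol by (simp add: fun_eq_iff)
    ultimately have "r i (r i v) \<in> X" "lam (r i (r i v)) = lam v"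
      using closed by (simp_all add: lam_r sq_invol)
    then show ?thesis using code_lam True by metis
  next
    case False
    then show ?thesis by (metis r_def)
  qed
  have cancel: "k = k'" if "v \<in> X" "k \<circ> fst (lam v) = k' \<circ> fst (lam v)" for v and k k' :: "'s \<Rightarrow> 's"
  proof -
    have "fst (lam v) \<in> gen \<rho> {..<n}" using lam_A[OF that(1)] by (auto simp: A_def)
    then obtain h where "fst (lam v) \<circ> h = id" using gen_inverse[of \<rho>, OF invol] by metis
    then show ?thesis using that(2) by (metis comp_assoc comp_id)
  qed
  have r_inj: "i = j" if "v \<in> X" "i < n" "j < n" "r i v = r j v" for i j v
  proof -
    have "\<rho> i \<circ> fst (lam v) = \<rho> j \<circ> fst (lam v)"
      using lam_r[OF that(1,2)] lam_r[OF that(1,3)] that(4) by simp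
    then have "\<rho> i = \<rho> j" by (rule cancel[OF that(1)])
    then show ?thesis using inj that by (auto simp: inj_on_def)
  qed
  have no_fix: "r i v \<noteq> v" if "v \<in> X" "i < n" for i v
  proof
    assume "r i v = v"
    then have "\<rho> i \<circ> fst (lam v) = id \<circ> fst (lam v)" using lam_r[OF that] by (metis fst_conv id_comp)
    then have "\<rho> i = id" by (rule cancel[OF that(1)])
    then show False using not_id[OF that(2)] by contradiction
  qed
  \<comment> \<open>The colour is well defined since \<open>r_inj\<close> leaves one colour per
    edge.\<close>
  define N where "N = \<lparr>flags = X, edges = {{v, r i v} | v i. v \<in> X \<and> i < n},
    colour = (\<lambda>e. THE i. i < n \<and> (\<exists>v \<in> X. e = {v, r i v}))\<rparr>"
  have "square_cover n N r \<rho> lam par"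
  proof
    show "colour N {u, r i u} = i" if u: "i < n" "u \<in> flags N" for i u
      unfolding N_def cgraph.simps
    proof (rule the_equality)
      have uX: "u \<in> X" using u by (simp add: N_def)
      then show "i < n \<and> (\<exists>v \<in> X. {u, r i u} = {v, r i v})" using u by blast
      fix j assume j: "j < n \<and> (\<exists>v \<in> X. {u, r i u} = {v, r j v})"
      then obtain v where v: "v \<in> X" "{u, r i u} = {v, r j v}" by blast
      then have "u = v \<and> r i u = r j v \<or> u = r j v \<and> r i u = v" by (simp add: doubleton_eq_iff)
      then show "j = i"
      proof
        assume "u = v \<and> r i u = r j v"
        then have "r i u = r j u" by auto
        then show ?thesis using r_inj[OF uX, of i j] u j by simp
      next
        assume "u = r j v \<and> r i u = v"
        then have "r i u = r j u" using rr by metis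
        then show ?thesis using r_inj[OF uX, of i j] u j by simp
      qed
    qed
    show "bij_betw lam (flags N) (gen \<rho> {..<n} \<times> UNIV)"
      unfolding A_def[symmetric]
      by (rule bij_betw_byWitness[where f' = code])
        (use lam_A code_lam lam_code code in \<open>auto simp: N_def\<close>)
  qed (use assms rr closed no_fix lam_r in \<open>simp_all add: N_def\<close>)
  then show ?thesis by blast
qed

section \<open>Relations of the group as isomorphism invariants\<close>

lemma (in square_cover) fixes_flag_iff:
  assumes w: "set w \<subseteq> {..<n}" "foldr sq w = id" and u: "u \<in> flags N"
  shows "foldr r w u = u \<longleftrightarrow> foldr \<rho> w = id"
proof -
  obtain h where h: "fst (lam u) \<circ> h = id"
    using gen_inverse[OF \<rho>_invol lam_gen[OF u]] by metis
  have "foldr r w u = u \<longleftrightarrow> lam (foldr r w u) = lam u"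
    using lam_inj foldr_closed[OF w(1) u] u by metis
  also have "\<dots> \<longleftrightarrow> foldr \<rho> w \<circ> fst (lam u) = fst (lam u)"
    unfolding lam_foldr[OF w(1) u] w(2) by (simp add: prod_eq_iff)
  also have "\<dots> \<longleftrightarrow> foldr \<rho> w = id" using h by (metis comp_assoc comp_id id_comp)
  finally show ?thesis .
qed

text \<open>A word trivial on the square fixes any given flag exactly when it is trivial in the
  group, and isomorphisms preserve whether a word fixes a flag.\<close>

lemma isomorphic_word_transfer:
  assumes "square_cover n N r \<rho> lam par" "square_cover n N' r' \<rho>' lam' par'" "isomorphic N N'"
    and w: "set w \<subseteq> {..<n}" "foldr sq w = id"
  shows "foldr \<rho> w = id \<longleftrightarrow> foldr \<rho>' w = id"
proof -
  interpret N: square_cover n N r \<rho> lam par by fact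
  interpret N': square_cover n N' r' \<rho>' lam' par' by fact
  obtain f where f: "isomorphism N N' f" using assms(3) by (auto simp: isomorphic_def)
  then have bij: "bij_betw f (flags N) (flags N')" by (simp add: isomorphism_def)
  obtain u where u: "u \<in> flags N" using N.flags_nonempty by blast
  have "foldr r' w (f u) = f u \<longleftrightarrow> f (foldr r w u) = f u"
    using isomorphism_foldr[OF N.flag_graph_axioms N'.flag_graph_axioms f u w(1)] by simp
  also have "\<dots> \<longleftrightarrow> foldr r w u = u"
    using bij u N.foldr_closed[OF w(1) u] by (auto simp: bij_betw_def inj_on_def)
  finally show ?thesis
    using N.fixes_flag_iff[OF w u] N'.fixes_flag_iff[OF w bij_betwE[OF bij, rule_format, OF u]] by simp
qed

section \<open>Rotations and reflections of the square as words\<close>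

lemma foldr_sq_rot:
  "set w \<subseteq> {..<3} \<Longrightarrow> foldr sq w (rot b x) = rot (b = even (length w)) (foldr sq w x)"
  by (induction w) (auto simp: sq_rot)

text \<open>An odd square is 1 modulo 4, the order of the rotation. So the exponent
  \<open>p * p\<close> keeps the rotation by one step while killing every element whose
  \<open>p\<close>-th power is trivial.\<close>

lemma funpow_rot_odd:
  assumes "odd p"
  shows "rot True ^^ (p * p) = rot True"
proof -
  obtain k where p: "p = 2 * k + 1" using assms by (elim oddE)
  then have "p * p = 4 * (k * k + k) + 1" by (simp add: algebra_simps)
  moreover have "rot True ^^ 4 = id" by (auto simp: fun_eq_iff rot_def numeral_eq_Suc)
  then have "rot True ^^ (4 * m) = id" for m by (simp add: funpow_mult[symmetric])
  ultimately have "rot True ^^ (p * p) = rot True ^^ 1" by (simp only: funpow_add comp_id id_comp)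
  then show ?thesis by simp
qed

text \<open>An odd word inverts rotations. Followed by a rotation that brings vertex 0 back it also
  fixes 0, and only negation does both.\<close>

lemma reflection_from_rotation:
  assumes w: "set w \<subseteq> {..<3}" "odd (length w)"
  shows "\<exists>m. (rot True ^^ m) \<circ> foldr sq w = sq 1"
proof -
  obtain m where m: "(rot True ^^ m) (foldr sq w (False, False)) = (False, False)"
    using rot_transitive by blast
  define f where "f = (rot True ^^ m) \<circ> foldr sq w"
  have comm: "(rot True ^^ k) (rot False x) = rot False ((rot True ^^ k) x)" for k x
    by (induction k) (auto simp: rot_def)
  have f_rot: "f (rot True x) = rot False (f x)" for x
    using foldr_sq_rot[OF w(1), of True x] w(2) comm by (simp add: f_def)
  have "f ((rot True ^^ k) (False, False)) = sq 1 ((rot True ^^ k) (False, False))" for k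
  proof (induction k)
    case 0
    then show ?case using m by (simp add: f_def sq_def)
  next
    case (Suc k)
    then show ?case by (simp add: f_rot sq_rot)
  qed
  then have "f y = sq 1 y" for y using rot_transitive[of "(False, False)" y] by metis
  then show ?thesis unfolding f_def by blast
qed

section \<open>Bits for the colours from 3 on\<close>

definition flip :: "'a \<Rightarrow> 'a set \<Rightarrow> 'a set" where
  "flip x S = (if x \<in> S then S - {x} else insert x S)"

lemma flip_flip: "flip x (flip x S) = S" "flip x (flip y S) = flip y (flip x S)"
  by (auto simp: flip_def)

lemma mem_flip: "y \<in> flip x S \<longleftrightarrow> (y \<in> S) \<noteq> (x = y)"
  by (auto simp: flip_def)

lemma finite_flip: "finite (flip x S) = finite S"
  by (auto simp: flip_def)

lemma odd_card_flip: "finite S \<Longrightarrow> odd (card (flip x S)) = even (card S)"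
  by (cases "x \<in> S") (auto simp: flip_def card_Diff_singleton_if card_gt_0_iff)

text \<open>
  For \<open>i \<ge> 3\<close>, the involution of colour \<open>i\<close> flips one of the two bits \<open>(i, True)\<close>, \<open>(i, False)\<close>.
  If \<open>i \<in> E\<close>, which bit it is changes whenever colour \<open>i - 1\<close> is applied: for \<open>i > 3\<close>
  always, and for \<open>i = 3\<close> at the base face. So \<open>i \<in> E\<close> exactly when the involutions of
  colours \<open>i - 1\<close> and \<open>i\<close> do not commute.
\<close>

definition bit_choice :: "(nat \<Rightarrow> 'a \<Rightarrow> 'a) \<Rightarrow> 'a \<Rightarrow> nat set \<Rightarrow> nat \<Rightarrow> 'a \<times> (nat \<times> bool) set \<Rightarrow> bool" where
  "bit_choice r u0 E i s \<longleftrightarrow> i \<in> E \<and>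
     (if i = 3 then fst s \<in> orb r {0, 1} u0
      else ((i - 1, True) \<in> snd s) \<noteq> ((i - 1, False) \<in> snd s))"

definition step :: "(nat \<Rightarrow> 'a \<Rightarrow> 'a) \<Rightarrow> 'a \<Rightarrow> nat set \<Rightarrow> nat \<Rightarrow> 'a \<times> (nat \<times> bool) set \<Rightarrow> 'a \<times> (nat \<times> bool) set" where
  "step r u0 E i s = (if i < 3 then (r i (fst s), snd s)
     else (fst s, flip (i, bit_choice r u0 E i s) (snd s)))"

text \<open>Reading the parity off the image of \<open>(u0, {})\<close> makes it depend on the group
  element, not on a word for it; each letter of colour at least 3 changes the size of the bit set by
  one.\<close>

definition flip_parity :: "'a \<Rightarrow> ('a \<times> (nat \<times> bool) set \<Rightarrow> 'a \<times> (nat \<times> bool) set) \<Rightarrow> bool" where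
  "flip_parity u0 g \<longleftrightarrow> odd (card (snd (g (u0, {}))))"

lemma foldr_step: "set w \<subseteq> {..<3} \<Longrightarrow> foldr (step r u0 E) w s = (foldr r w (fst s), snd s)"
  by (induction w) (auto simp: step_def)

lemma finite_snd_foldr_step: "finite (snd s) \<Longrightarrow> finite (snd (foldr (step r u0 E) w s))"
  by (induction w) (auto simp: step_def finite_flip)

context regular_map_action
begin

text \<open>The choice at colour \<open>i\<close> ignores the bits of index \<open>i\<close>, so a
  second application flips the same bit back.\<close>

lemma step_invol: "step r u0 E i (step r u0 E i s) = s"
proof -
  have "bit_choice r u0 E i (fst s, flip (i, b) (snd s)) = bit_choice r u0 E i s" if "3 \<le> i" for b
    using that by (auto simp: bit_choice_def mem_flip)
  then show ?thesis by (auto simp: step_def flip_flip prod_eq_iff)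
qed

lemma face_mem: "i \<le> 1 \<Longrightarrow> r i u \<in> orb r {0, 1} u0 \<longleftrightarrow> u \<in> orb r {0, 1} u0"
proof -
  assume "i \<le> 1"
  then have "i \<in> {0, 1}" by auto
  then show ?thesis using orb_step[of _ r "{0, 1}" u0 i] invol by metis
qed

text \<open>The choice at a colour reacts only to the preceding colour: at colour 3 it is constant
  on faces, hence blind to colours 0 and 1, and beyond that it sees only bits of the preceding
  index.\<close>

lemma step_comm:
  assumes "\<bar>int i - int j\<bar> > 1"
  shows "step r u0 E i \<circ> step r u0 E j = step r u0 E j \<circ> step r u0 E i"
proof -
  have *: "step r u0 E i (step r u0 E j s) = step r u0 E j (step r u0 E i s)"
    if ij: "i + 1 < j" for i j s
  proof (cases "j < 3")
    case True
    then have "i = 0" "j = 2" using ij by auto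
    then show ?thesis using comm02 by (simp add: step_def fun_eq_iff)
  next
    case False
    show ?thesis
    proof (cases "i < 3")
      case True
      have "bit_choice r u0 E j (r i (fst s), snd s) = bit_choice r u0 E j s"
        using True False ij face_mem[of i] by (auto simp: bit_choice_def)
      then show ?thesis using True False by (simp add: step_def)
    next
      case i: False
      have "bit_choice r u0 E j (fst s, flip (i, b) (snd s)) = bit_choice r u0 E j s"
        "bit_choice r u0 E i (fst s, flip (j, b) (snd s)) = bit_choice r u0 E i s" for b
        using ij i by (auto simp: bit_choice_def mem_flip)
      then show ?thesis using i False by (simp add: step_def flip_flip(2))
    qed
  qed
  show ?thesis
  proof (cases "i < j")
    case True
    then show ?thesis using assms *[of i j] by (auto simp: fun_eq_iff)
  next
    case False
    then show ?thesis using assms *[of j i] by (auto simp: fun_eq_iff)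
  qed
qed

lemma step_square_cover:
  assumes u0: "u0 \<in> flags M" and n: "3 \<le> n"
    and pq: "(r 0 \<circ> r 1) ^^ p = id" "(r 2 \<circ> r 1) ^^ q = id" "odd p \<or> odd q"
  shows "\<exists>(N :: nat cgraph) s lam. square_cover n N s (step r u0 E) lam (flip_parity u0)"
proof (rule exists_square_cover[OF n step_invol step_comm])
  have *: "step r u0 E i (u0, {}) \<noteq> step r u0 E j (u0, {})" if "i < j" for i j
  proof (cases "j < 3")
    case True
    then show ?thesis using that r_inj[of i j u0] u0 by (auto simp: step_def)
  next
    case False
    then show ?thesis using that by (auto simp: step_def flip_def)
  qed
  show "inj_on (step r u0 E) {..<n}"
    by (rule inj_onI) (metis * linorder_neqE_nat)
  show "step r u0 E i \<noteq> id" if "i < n" for i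
  proof
    assume "step r u0 E i = id"
    then have "step r u0 E i (u0, {}) = (u0, {})" by simp
    then show False using no_fix[of i u0] u0 by (auto simp: step_def flip_def split: if_splits)
  qed
  have trivial: "foldr (step r u0 E) w = id" if "set w \<subseteq> {..<3}" "foldr r w = id" for w
    using that by (auto simp: fun_eq_iff foldr_step)
  obtain t where t: "set t \<subseteq> {..<3}" "even (length t)" "foldr r t = id" "foldr sq t = rot True"
  proof -
    \<comment> \<open>The product of colours \<open>i\<close> and 1 rotates the square by one step
      for \<open>i = 0\<close> and \<open>i = 2\<close>. The exponent \<open>k * k\<close> preserves
      this for odd \<open>k\<close> and makes the word trivial on \<open>M\<close>.\<close>
    define T where "T i k = concat (replicate (k * k) [i, 1 :: nat])" for i k :: nat
    have T: "i < 3 \<Longrightarrow> set (T i k) \<subseteq> {..<3}" "even (length (T i k))" "foldr r (T i k) = ((r i \<circ> r 1) ^^ k) ^^ k"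
      "foldr sq (T i k) = (sq i \<circ> sq 1) ^^ (k * k)" for i k
      unfolding T_def foldr_concat_replicate
      by (auto simp: length_concat sum_list_replicate funpow_mult)
    have sq_rot: "sq 0 \<circ> sq 1 = rot True" "sq 2 \<circ> sq 1 = rot True"
      by (auto simp: fun_eq_iff sq_def rot_def)
    from pq(3) show thesis
    proof
      assume "odd p"
      then show thesis using T[of 0 p] pq(1) that[of "T 0 p"]
        by (simp add: sq_rot[simplified] funpow_rot_odd)
    next
      assume "odd q"
      then show thesis using T[of 2 q] pq(2) that[of "T 2 q"]
        by (simp add: sq_rot[simplified] funpow_rot_odd)
    qed
  qed
  then show "\<exists>w. set w \<subseteq> {..<3} \<and> foldr (step r u0 E) w = id \<and> foldr sq w = rot True"
    using trivial by blast
  obtain w where w: "set w \<subseteq> {..<3}" "odd (length w)" "foldr r w = id" by (rule odd_word)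
  obtain m where m: "(rot True ^^ m) \<circ> foldr sq w = sq 1" using reflection_from_rotation w by blast
  \<comment> \<open>Copies of the even word \<open>t\<close>, trivial on \<open>M\<close>, turn the
    reflection given by \<open>w\<close> into \<open>sq 1\<close> and keep the length odd.\<close>
  define v where "v = concat (replicate m t) @ w"
  have "foldr r v = id"
    by (rule ext) (simp add: v_def foldr_concat_replicate t(3) w(3))
  moreover have "set v \<subseteq> {..<3}" "odd (length v)"
    using t w by (auto simp: v_def length_concat sum_list_replicate)
  moreover have "foldr sq v = sq 1"
    unfolding m[symmetric] by (rule ext) (simp add: v_def foldr_concat_replicate t(4))
  ultimately show "\<exists>w. set w \<subseteq> {..<3} \<and> odd (length w) \<and> foldr (step r u0 E) w = id \<and> foldr sq w = sq 1"
    using trivial by blast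
  fix i g assume "g \<in> gen (step r u0 E) {..<n}"
  then have "finite (snd (g (u0, {})))" using finite_snd_foldr_step[of "(u0, {})"] by (auto simp: gen_def)
  then show "flip_parity u0 (step r u0 E i \<circ> g) \<longleftrightarrow> flip_parity u0 g \<noteq> (3 \<le> i)"
    by (auto simp: flip_parity_def step_def odd_card_flip)
qed

text \<open>The word is the commutator of two consecutive colours; its triviality is a relation
  through which \<open>E\<close> can be recovered from the graph.\<close>

lemma step_adjacent_commute_iff:
  assumes u0: "u0 \<in> flags M" and i: "3 \<le> i" and face: "r 2 u0 \<notin> orb r {0, 1} u0"
  shows "foldr (step r u0 E) [i - 1, i, i - 1, i] = id \<longleftrightarrow> i \<notin> E"
proof (cases "i \<in> E")
  case False
  have "step r u0 E (i - 1) (step r u0 E i s) = step r u0 E i (step r u0 E (i - 1) s)" for s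
  proof -
    have "bit_choice r u0 E (i - 1) (fst s, flip (i, b) (snd s)) = bit_choice r u0 E (i - 1) s"
      if "4 \<le> i" for b
      using that by (auto simp: bit_choice_def mem_flip)
    moreover have "\<not> bit_choice r u0 E i t" for t using False by (simp add: bit_choice_def)
    ultimately show ?thesis using i by (auto simp: step_def flip_flip(2))
  qed
  then show ?thesis using False by (simp add: fun_eq_iff step_invol)
next
  case True
  \<comment> \<open>The colour \<open>i - 1\<close> applied in between changes the choice, so the
    two applications of colour \<open>i\<close> flip different bits and \<open>(i, True)\<close>
    stays set.\<close>
  have "(i, True) \<in> snd (foldr (step r u0 E) [i - 1, i, i - 1, i] (u0, {}))"
  proof (cases "i = 3")
    case True
    then show ?thesis using \<open>i \<in> E\<close> face orb_refl[of u0 r] by (simp add: step_def bit_choice_def mem_flip)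
  next
    case False
    then have "\<not> i - 1 < 3" "i \<noteq> 3" "\<not> i < 3" "i - 1 \<noteq> i" using i by auto
    then show ?thesis using \<open>i \<in> E\<close>
      by (simp add: step_def bit_choice_def[of r u0 E i] mem_flip)
  qed
  then show ?thesis using True by (metis empty_iff id_apply snd_conv)
qed

lemma step_covers:
  assumes u0: "u0 \<in> flags M" and N: "square_cover 3 N s (step r u0 E) lam par"
  shows "covers N M"
proof -
  interpret N: square_cover 3 N s "step r u0 E" lam par by fact
  \<comment> \<open>The covering map evaluates the group element at the base flag, forgetting bits
    and square.\<close>
  define f where "f v = fst (fst (lam v) (u0, {}))" for v
  have "f ` flags N = flags M"
  proof (intro equalityI subsetI)
    fix x assume "x \<in> f ` flags N"
    then obtain v where v: "x = f v" "v \<in> flags N" by blast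
    then obtain w where "fst (lam v) = foldr (step r u0 E) w" "set w \<subseteq> {..<3}"
      using N.lam_gen by (auto simp: gen_def)
    then show "x \<in> flags M" using foldr_closed u0 by (simp add: v(1) f_def foldr_step)
  next
    fix x assume "x \<in> flags M"
    then obtain w where w: "x = foldr r w u0" "set w \<subseteq> {..<3}"
      using connected[OF u0] by (auto simp: orb_def)
    define v where "v = N.unlam (foldr (step r u0 E) w, (False, False))"
    have "foldr (step r u0 E) w \<in> gen (step r u0 E) {..<3}" using w(2) by (auto simp: gen_def)
    then have "v \<in> flags N" "f v = x"
      unfolding v_def f_def using N.unlam w by (auto simp: foldr_step)
    then show "x \<in> f ` flags N" by blast
  qed
  moreover have "adjacent M i (f u) (f v)" if "u \<in> flags N" "adjacent N i u v" for i u v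
  proof -
    have v: "i < 3" "v = s i u" using that(2) by (auto simp: N.adjacent_iff)
    then have "f v = r i (f u)" using N.lam_r[OF v(1) that(1)] by (simp add: f_def step_def)
    then show ?thesis using v(1) that(1) \<open>f ` flags N = flags M\<close> by (auto simp: adjacent_iff)
  qed
  ultimately show ?thesis unfolding covers_def by blast
qed

end

theorem theorem1p1:
  fixes M :: "'a cgraph" and p q :: nat
  assumes "regular_map M"
    and "\<not> orientable M"
    and "has_type M p q"
    and "odd p \<or> odd q"
  shows "\<exists>M\<omega> :: nat cgraph.
    maniplex 3 M\<omega> \<and> unstable M\<omega> \<and> fully_transitive 3 M\<omega> \<and> k_orbit 2 M\<omega> \<and> covers M\<omega> M \<and>
    (\<forall>n > 3. \<exists>S :: nat cgraph set.
       card S = 2 ^ (n - 3) \<and>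
       (\<forall>N \<in> S. maniplex n N \<and> unstable N \<and> fully_transitive n N \<and> k_orbit 2 N \<and>
          (\<forall>F \<in> conn_components (colour_subgraph N {0, 1, 2}). isomorphic F M\<omega>)) \<and>
       pairwise (\<lambda>N N'. \<not> isomorphic N N') S)"
proof -
  define r where "r = partner M"
  interpret M: regular_map_action M r
    unfolding r_def by (rule regular_map_action_partner[OF assms(1,2)])
  obtain u0 where u0: "u0 \<in> flags M"
    using assms(1) by (auto simp: regular_map_def maniplex_def connected_graph_def)
  have rel: "(r 0 \<circ> r 1) ^^ p = id" "(r 2 \<circ> r 1) ^^ q = id" "(r 1 \<circ> r 2) ^^ q = id"
    using assms(3) by (auto simp: has_type_def insert_commute intro!: M.type_relation)
  have face: "r 2 u0 \<notin> orb r {0, 1} u0"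
    using M.adjacent_face_neq u0 rel assms(4) by blast
  have ex: "\<exists>(N :: nat cgraph) s lam. square_cover n N s (step r u0 E) lam (flip_parity u0)"
    if "3 \<le> n" for n E
    using M.step_square_cover[OF u0 that] rel assms(4) by blast
  \<comment> \<open>On colours 0, 1, 2 \<open>step\<close> does not depend on \<open>E\<close>, so
    \<open>M\<omega>\<close> is the common 3-face of the whole family.\<close>
  obtain M\<omega> :: "nat cgraph" and s lam where M\<omega>: "square_cover 3 M\<omega> s (step r u0 {}) lam (flip_parity u0)"
    using ex by blast
  interpret M\<omega>: square_cover 3 M\<omega> s "step r u0 {}" lam "flip_parity u0" by (rule M\<omega>)
  have "\<exists>S :: nat cgraph set. card S = 2 ^ (n - 3) \<and>
       (\<forall>N \<in> S. maniplex n N \<and> unstable N \<and> fully_transitive n N \<and> k_orbit 2 N \<and>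
          (\<forall>F \<in> conn_components (colour_subgraph N {0, 1, 2}). isomorphic F M\<omega>)) \<and>
       pairwise (\<lambda>N N'. \<not> isomorphic N N') S"
    if n: "3 < n" for n
  proof -
    obtain N :: "nat set \<Rightarrow> nat cgraph" where
      "\<exists>s lam. square_cover n (N E) s (step r u0 E) lam (flip_parity u0)" for E
      using ex[of n] n by (metis less_imp_le)
    then obtain s lam where N: "square_cover n (N E) (s E) (step r u0 E) (lam E) (flip_parity u0)" for E
      by metis
    have noniso: "E = E'" if iso: "isomorphic (N E) (N E')" and E: "E \<subseteq> {3..<n}" "E' \<subseteq> {3..<n}" for E E'
    proof -
      have "i \<in> E \<longleftrightarrow> i \<in> E'" if "i \<in> {3..<n}" for i
      proof -
        have i: "3 \<le> i" "set [i - 1, i, i - 1, i] \<subseteq> {..<n}" using that by auto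
        \<comment> \<open>Colour \<open>i\<close> acts trivially on the square and the involution of
          colour \<open>i - 1\<close> occurs twice.\<close>
        have "foldr sq [i - 1, i, i - 1, i] = id" using i by (auto simp: fun_eq_iff sq_def)
        from isomorphic_word_transfer[OF N N iso i(2) this] show ?thesis
          unfolding M.step_adjacent_commute_iff[OF u0 i(1) face] by blast
      qed
      then show ?thesis using E by blast
    qed
    have refl: "isomorphic H H" for H :: "nat cgraph"
      unfolding isomorphic_def isomorphism_def by (intro exI[of _ id]) auto
    \<comment> \<open>Equal graphs are isomorphic, so distinct sets \<open>E\<close> give distinct
      graphs and the family is as large as the power set of \<open>{3..<n}\<close>.\<close>
    have "inj_on N (Pow {3..<n})"
    proof (rule inj_onI)
      fix E E' assume "E \<in> Pow {3..<n}" "E' \<in> Pow {3..<n}" "N E = N E'"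
      then show "E = E'" using noniso[of E E'] refl[of "N E"] by simp
    qed
    then have "card (N ` Pow {3..<n}) = 2 ^ (n - 3)" by (simp add: card_image card_Pow)
    moreover have "pairwise (\<lambda>N N'. \<not> isomorphic N N') (N ` Pow {3..<n})"
      unfolding pairwise_def using noniso by blast
    moreover have "isomorphic F M\<omega>" if "F \<in> conn_components (colour_subgraph (N E) {0, 1, 2})" for E F
      using component_isomorphic[OF N M\<omega> _ that] by (simp add: step_def fun_eq_iff)
    ultimately show ?thesis
      using square_cover.maniplex[OF N] square_cover.unstable[OF N]
        square_cover.fully_transitive[OF N] square_cover.two_orbit[OF N]
      by (intro exI[of _ "N ` Pow {3..<n}"]) auto
  qed
  then show ?thesis
    using M\<omega>.maniplex M\<omega>.unstable M\<omega>.fully_transitive M\<omega>.two_orbit M.step_covers[OF u0 M\<omega>]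
    by blast
qed

end
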